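(* Let $T:X\to X$ be an invertible adjoint operator on a separable dual Banach space $X$. Then $$\overline{\operatorname{RRec}(T)}=\overline{\operatorname{FRec}(T)}=\overline{\operatorname{FRec}(T^{-1})}=\overline{\operatorname{RRec}(T^{-1})}.$$ Moreover: (a) $T$ is reiteratively (and hence frequently) recurrent if and only if so is $T^{-1}$. (b) If $\operatorname{RRec}(T)\setminus\{0\}\neq\varnothing$ then $[\operatorname{FRec}(T)\cap\operatorname{FRec}(T^{-1})]\setminus\{0\}\neq\varnothing$. In particular, the result holds whenever $T$ is an (invertible bounded linear) operator on a reflexive Banach space $X$.
   Context: Banach spaces may be real or complex. $\mathbb{N}_0=\{0,1,2,\dots\}$. "Adjoint operator on a separable dual Banach space" means: $X=Y^*$ is the dual of a Banach space $Y$, $X$ is norm-separable, and $T=S^*$ for some bounded linear operator $S:Y\to Y$. Closures are in the norm topology. For an operator $S$ on $X$, $N_S(x,A)=\{n\in\mathbb{N}_0: S^nx\in A\}$. For $A\subset\mathbb{N}_0$: $\underline{\operatorname{dens}}(A)=\liminf_{N\to\infty}\frac{\operatorname{card}(A\cap[0,N])}{N+1}$ and $\overline{\operatorname{Bd}}(A)=\limsup_{N\to\infty}\left(\max_{m\ge0}\frac{\operatorname{card}(A\cap[m,m+N])}{N+1}\right)$. $\operatorname{FRec}(S)$ (resp. $\operatorname{RRec}(S)$) is the set of points $x$ such that $\underline{\operatorname{dens}}(N_S(x,U))>0$ (resp. $\overline{\operatorname{Bd}}(N_S(x,U))>0$) for every norm neighbourhood $U$ of $x$. $S$ is frequently (resp.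 reiteratively) recurrent if $\operatorname{FRec}(S)$ (resp. $\operatorname{RRec}(S)$) is dense in $X$. *)

theory Defs
  imports "HOL-Analysis.Analysis"
begin

section \<open>Real and complex normed spaces\<close>

text \<open>
  The scalar field is a type of sort \<open>{real_normed_field, euclidean_space}\<close>.  Both \<^typ>\<open>real\<close> and
  \<^typ>\<open>complex\<close> have this sort, and up to isometric isomorphism they are the only such fields
  (Gelfand--Mazur).  A normed space over \<open>'k\<close> is a real normed vector space whose scalar
  multiplication is extended to \<open>'k\<close>; the second assumption makes \<open>scale\<close> coincide with \<open>scaleR\<close>
  when \<open>'k\<close> is \<^typ>\<open>real\<close>.  Completeness is supplied by the class \<^class>\<open>banach\<close> where needed.
\<close>

locale normed_space_over = vector_space scale
  for scale :: "'k::{real_normed_field, euclidean_space} \<Rightarrow> 'a::real_normed_vector \<Rightarrow> 'a" +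
  assumes norm_scale: "norm (scale c x) = norm c * norm x"
    and scale_of_real: "scale (of_real r) x = r *\<^sub>R x"

lemma normed_space_over_scaleR:
  "normed_space_over (scaleR :: real \<Rightarrow> 'a::real_normed_vector \<Rightarrow> 'a)"
  by unfold_locales (auto simp: algebra_simps)

lemma normed_space_over_mult:
  "normed_space_over ((*) :: 'k::{real_normed_field, euclidean_space} \<Rightarrow> 'k \<Rightarrow> 'k)"
  by unfold_locales (auto simp: algebra_simps norm_mult scaleR_conv_of_real)

text \<open>
  Duals appear below as sets of bounded real-linear maps, so spaces are carrier sets \<open>X\<close> inside a
  normed type and maps between them are only relevant on the carrier.
\<close>

definition bounded_linear_on ::
  "('k \<Rightarrow> 'a \<Rightarrow> 'a) \<Rightarrow> ('k \<Rightarrow> 'b \<Rightarrow> 'b) \<Rightarrow> 'a::real_normed_vector set \<Rightarrow>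
    ('a \<Rightarrow> 'b::real_normed_vector) \<Rightarrow> bool" where
  "bounded_linear_on sA sB X T \<longleftrightarrow>
     (\<forall>x\<in>X. \<forall>y\<in>X. T (x + y) = T x + T y) \<and>
     (\<forall>c. \<forall>x\<in>X. T (sA c x) = sB c (T x)) \<and>
     (\<exists>K. \<forall>x\<in>X. norm (T x) \<le> K * norm x)"

definition operator_on ::
  "('k \<Rightarrow> 'a \<Rightarrow> 'a) \<Rightarrow> 'a::real_normed_vector set \<Rightarrow> ('a \<Rightarrow> 'a) \<Rightarrow> bool" where
  "operator_on s X T \<longleftrightarrow> T ` X \<subseteq> X \<and> bounded_linear_on s s X T"

text \<open>The inverse operator of \<open>T\<close> on \<open>X\<close> is \<open>inv_into X T\<close>.\<close>

definition invertible_operator_on ::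
  "('k \<Rightarrow> 'a \<Rightarrow> 'a) \<Rightarrow> 'a::real_normed_vector set \<Rightarrow> ('a \<Rightarrow> 'a) \<Rightarrow> bool" where
  "invertible_operator_on s X T \<longleftrightarrow>
     operator_on s X T \<and> bij_betw T X X \<and> operator_on s X (inv_into X T)"


section \<open>Duals, adjoints, reflexivity\<close>

text \<open>
  The norm of \<^typ>\<open>'a \<Rightarrow>\<^sub>L 'k\<close> is the operator norm, so \<open>dual_space s\<close> carries the usual dual norm; it
  is all of \<open>UNIV\<close> when \<open>'k\<close> is \<^typ>\<open>real\<close>.
\<close>

definition dual_space ::
  "('k \<Rightarrow> 'a \<Rightarrow> 'a) \<Rightarrow>
    ('a::real_normed_vector \<Rightarrow>\<^sub>L 'k::{real_normed_field, euclidean_space}) set" where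
  "dual_space s = {f. \<forall>c x. blinfun_apply f (s c x) = c * blinfun_apply f x}"

definition dual_scale ::
  "'k::{real_normed_field, euclidean_space} \<Rightarrow> ('a::real_normed_vector \<Rightarrow>\<^sub>L 'k) \<Rightarrow> ('a \<Rightarrow>\<^sub>L 'k)" where
  "dual_scale c f = blinfun_mult_right c o\<^sub>L f"

lemma dual_scale_apply: "blinfun_apply (dual_scale c f) x = c * blinfun_apply f x"
  by (simp add: dual_scale_def)

definition is_adjoint ::
  "('k \<Rightarrow> 'a \<Rightarrow> 'a) \<Rightarrow>
    (('a::real_normed_vector \<Rightarrow>\<^sub>L 'k::{real_normed_field, euclidean_space}) \<Rightarrow> ('a \<Rightarrow>\<^sub>L 'k)) \<Rightarrow> bool" where
  "is_adjoint s T \<longleftrightarrow>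
     (\<exists>S :: 'a \<Rightarrow>\<^sub>L 'a. (\<forall>c x. blinfun_apply S (s c x) = s c (blinfun_apply S x)) \<and>
        (\<forall>f\<in>dual_space s. T f = f o\<^sub>L S))"

text \<open>Every bounded functional on the dual is evaluation at a point of the space.\<close>

definition reflexive_space ::
  "('k::{real_normed_field, euclidean_space} \<Rightarrow> 'a::real_normed_vector \<Rightarrow> 'a) \<Rightarrow> bool" where
  "reflexive_space s \<longleftrightarrow>
     (\<forall>\<phi> :: ('a \<Rightarrow>\<^sub>L 'k) \<Rightarrow> 'k. bounded_linear_on dual_scale (*) (dual_space s) \<phi> \<longrightarrow>
        (\<exists>x. \<forall>f\<in>dual_space s. \<phi> f = blinfun_apply f x))"


section \<open>Frequent and reiterative recurrence\<close>

definition lower_density :: "nat set \<Rightarrow> ereal" where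
  "lower_density A = liminf (\<lambda>N. ereal (real (card (A \<inter> {0..N})) / real (N + 1)))"

text \<open>The supremum over \<open>m\<close> is a maximum, since the cardinalities take at most \<open>N + 2\<close> values.\<close>

definition upper_Banach_density :: "nat set \<Rightarrow> ereal" where
  "upper_Banach_density A =
     limsup (\<lambda>N. SUP m. ereal (real (card (A \<inter> {m..m + N})) / real (N + 1)))"

definition return_set :: "('a \<Rightarrow> 'a) \<Rightarrow> 'a \<Rightarrow> 'a set \<Rightarrow> nat set" where
  "return_set T x A = {n. (T ^^ n) x \<in> A}"

definition nhd_in :: "'a::topological_space set \<Rightarrow> 'a \<Rightarrow> 'a set \<Rightarrow> bool" where
  "nhd_in X x U \<longleftrightarrow> U \<subseteq> X \<and> (\<exists>V. openin (top_of_set X) V \<and> x \<in> V \<and> V \<subseteq> U)"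

definition FRec :: "'a::topological_space set \<Rightarrow> ('a \<Rightarrow> 'a) \<Rightarrow> 'a set" where
  "FRec X T = {x \<in> X. \<forall>U. nhd_in X x U \<longrightarrow> lower_density (return_set T x U) > 0}"

definition RRec :: "'a::topological_space set \<Rightarrow> ('a \<Rightarrow> 'a) \<Rightarrow> 'a set" where
  "RRec X T = {x \<in> X. \<forall>U. nhd_in X x U \<longrightarrow> upper_Banach_density (return_set T x U) > 0}"

text \<open>
  \<open>closure\<close> is taken in the ambient type; for the carriers used here (\<open>UNIV\<close> and \<open>dual_space s\<close>,
  which is closed) it agrees with the closure in \<open>X\<close>.
\<close>

definition frequently_recurrent :: "'a::topological_space set \<Rightarrow> ('a \<Rightarrow> 'a) \<Rightarrow> bool" where
  "frequently_recurrent X T \<longleftrightarrow> X \<subseteq> closure (FRec X T)"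

definition reiteratively_recurrent :: "'a::topological_space set \<Rightarrow> ('a \<Rightarrow> 'a) \<Rightarrow> bool" where
  "reiteratively_recurrent X T \<longleftrightarrow> X \<subseteq> closure (RRec X T)"

end

theory Submission
  imports Defs
begin

text \<open>
  Everything follows from one approximation statement: if \<open>x\<close> is reiteratively recurrent, then every
  ball around \<open>x\<close> contains a point that is frequently recurrent for \<open>T\<close> and for \<open>T\<inverse>\<close> at once.  Indeed,
  all four closures then equal the closure of \<open>FRec T \<inter> FRec T\<inverse>\<close>, and a ball around \<open>x \<noteq> 0\<close> that misses
  \<open>0\<close> gives part (b).

  The classical way to find such points is to turn the returns of \<open>x\<close> to a weak-star compact ball \<open>U\<close>
  into a \<open>T\<close>-invariant measure charging \<open>U\<close>, and to apply the ergodic theorem.  Only a fragment of that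
  argument is needed, and it can be carried out on the two-sided orbit of \<open>x\<close> itself.  Choose windows of
  integers, of growing length, in which the orbit spends at least a proportion \<open>\<delta> > 0\<close> of the time in
  \<open>U\<close>; the proportion of time spent in a set plays the role of its measure.  Let \<open>B\<^sub>0, B\<^sub>1, \<dots>\<close> be a countable base of
  small closed balls.  A point of \<open>U\<close> that fails to be frequently recurrent for \<open>T\<close> or for \<open>T\<inverse>\<close> lies in
  the bad set of some \<open>B\<^sub>k\<close>: the points of \<open>B\<^sub>k\<close> for which some initial segment of the forward or backward
  orbit visits \<open>B\<^sub>k\<close> with frequency below \<open>\<eta>\<^sub>k\<close>.  A greedy count, which replaces the maximal ergodic
  inequality, shows that an orbit visits such a set with frequency at most about \<open>\<eta>\<^sub>k\<close>.  To add up these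
  estimates over \<open>k\<close> one needs an analogue of countable additivity, and compactness provides it: each bad
  set is covered by relatively open sets whose finite unions still have small frequency
  (\<open>poorly_visited_cover\<close>), so if the bad sets covered \<open>U\<close>, finitely many of these open sets would, and
  the total frequency would be below \<open>\<delta>\<close>.  Hence \<open>U\<close> contains a point outside all bad sets
  (\<open>frequently_recurrent_near\<close>).

  The argument uses two topologies: a separable norm, which makes the base countable, and a Hausdorff
  topology in which closed balls are compact and \<open>T\<close> is continuous.  They are combined in the locale
  \<open>compact_ball_dynamics\<close>.  On a separable dual the second topology is the weak-star topology, for which
  adjoints are continuous.  On a reflexive space it is the weak topology; as the space need not be
  separable, the argument is run inside the closed subspace generated by the two-sided orbit of \<open>x\<close>.
  That balls of this subspace are weakly compact rests on the Hahn--Banach theorem, proved here through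
  minimal sublinear functionals.
\<close>

section \<open>Sparse returns along windows of integers\<close>

text \<open>
  The windows have to be thinned out so that countably many frequencies converge simultaneously.  This
  is sequential compactness of a countable product of intervals.
\<close>

lemma common_convergent_subsequence:
  fixes f :: "nat \<Rightarrow> 'i::countable \<Rightarrow> real"
  assumes "\<And>j i. f j i \<in> {0..1}"
  shows "\<exists>r. strict_mono r \<and> (\<forall>i. convergent (\<lambda>j. f (r j) i))"
proof -
  let ?K = "PiE UNIV (\<lambda>_::'i. {0..1::real})"
  have "compactin (product_topology (\<lambda>_. euclidean) UNIV) ?K"
    by (simp add: compactin_PiE compact_Icc)
  then have "compact ?K"
    by (simp add: euclidean_product_topology)
  then have "seq_compact ?K"
    by (rule compact_imp_seq_compact)
  moreover have "\<forall>j. f j \<in> ?K"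
    using assms by (auto simp: PiE_def)
  ultimately obtain l r where r: "strict_mono (r :: nat \<Rightarrow> nat)" and l: "(f \<circ> r) \<longlonglongrightarrow> l"
    unfolding seq_compact_def by metis
  have "(\<lambda>j. f (r j) i) \<longlonglongrightarrow> l i" for i
  proof -
    have "isCont (\<lambda>x::'i \<Rightarrow> real. x i) l"
      using continuous_on_product_coordinates[of i] continuous_on_eq_continuous_at[OF open_UNIV]
      by blast
    from isCont_tendsto_compose[OF this l] show ?thesis
      by (simp add: o_def)
  qed
  with r show ?thesis
    by (auto simp: convergent_def)
qed

text \<open>
  Scan the window from left to right.  A time outside \<open>A \<inter> E\<close> is skipped; at a time in \<open>E\<close> one jumps over
  the sparse block of length \<open>N\<close> that starts there.  The blocks are disjoint, and only the last one can
  stick out of the window, which costs at most \<open>L\<close>.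
\<close>

lemma card_greedy_forward:
  fixes A E :: "int set" and \<eta> :: real
  assumes \<eta>: "0 \<le> \<eta>"
    and sparse: "\<And>m. m \<in> E \<Longrightarrow> \<exists>N\<in>{1..L}. card {k\<in>{..<N}. m + int k \<in> A} \<le> \<eta> * real N"
  shows "card (A \<inter> E \<inter> {a..<a + int M}) \<le> \<eta> * real M + real L"
proof (induction M arbitrary: a rule: less_induct)
  case (less M)
  let ?J = "{a..<a + int M}"
  consider "M = 0" | "M > 0" "a \<notin> A \<inter> E" | "a \<in> E" by auto
  then show ?case
  proof cases
    case 1
    then show ?thesis by simp
  next
    case 2
    then have "A \<inter> E \<inter> ?J = A \<inter> E \<inter> {a + 1..<a + 1 + int (M - 1)}"
      by (auto simp: of_nat_diff order_le_less)
    moreover have "\<eta> * real (M - 1) \<le> \<eta> * real M"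
      using \<eta> by (intro mult_left_mono) auto
    ultimately show ?thesis
      using less[of "M - 1" "a + 1"] 2 by simp
  next
    case 3
    then obtain N where N: "1 \<le> N" "N \<le> L" "card {k\<in>{..<N}. a + int k \<in> A} \<le> \<eta> * real N"
      using sparse by force
    show ?thesis
    proof (cases "M \<le> N")
      case True
      have "card (A \<inter> E \<inter> ?J) \<le> card ?J"
        by (intro card_mono) auto
      then show ?thesis
        using True N \<eta> by (simp add: add_increasing)
    next
      case False
      have "A \<inter> E \<inter> ?J \<subseteq> (\<lambda>k. a + int k) ` {k\<in>{..<N}. a + int k \<in> A}
              \<union> A \<inter> E \<inter> {a + int N..<a + int N + int (M - N)}" (is "_ \<subseteq> ?I \<union> ?R")
      proof
        fix x assume x: "x \<in> A \<inter> E \<inter> ?J"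
        show "x \<in> ?I \<union> ?R"
        proof (cases "x < a + int N")
          case True
          then have "x = a + int (nat (x - a))" "nat (x - a) < N" using x by auto
          then show ?thesis using x by force
        qed (use x False in \<open>auto simp: of_nat_diff\<close>)
      qed
      then have "card (A \<inter> E \<inter> ?J) \<le> card (?I \<union> ?R)"
        by (intro card_mono) auto
      also have "\<dots> \<le> card ?I + card ?R"
        by (rule card_Un_le)
      finally have "real (card (A \<inter> E \<inter> ?J)) \<le> real (card ?I) + real (card ?R)"
        by linarith
      also have "real (card ?I) \<le> \<eta> * real N"
        using N card_image_le[of "{k\<in>{..<N}. a + int k \<in> A}" "\<lambda>k. a + int k"] by simp
      also have "real (card ?R) \<le> \<eta> * real (M - N) + real L"
        using less[of "M - N" "a + int N"] N False by simp
      finally show ?thesis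
        using False by (simp add: of_nat_diff algebra_simps)
    qed
  qed
qed

text \<open>
  The backward orbit of a point is scanned from right to left, so the reflection \<open>m \<mapsto> - m\<close> reduces the
  case \<open>s = -1\<close> to the forward one.
\<close>

lemma card_greedy:
  fixes A E :: "int set" and \<eta> :: real
  assumes \<eta>: "0 \<le> \<eta>" and s: "s = 1 \<or> s = -1"
    and sparse: "\<And>m. m \<in> E \<Longrightarrow> \<exists>N\<in>{1..L}. card {k\<in>{..<N}. m + s * int k \<in> A} \<le> \<eta> * real N"
  shows "card (A \<inter> E \<inter> {a..<a + int M}) \<le> \<eta> * real M + real L"
proof (cases "s = 1")
  case True
  then show ?thesis using card_greedy_forward[OF \<eta>, of E L A a M] sparse by simp
next
  case False
  then have s: "s = -1" using s by simp
  have "\<exists>N\<in>{1..L}. card {k\<in>{..<N}. m + int k \<in> uminus -` A} \<le> \<eta> * real N"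
    if "m \<in> uminus -` E" for m
    using sparse[of "- m"] s that by simp
  from card_greedy_forward[OF \<eta>, of "uminus -` E" L "uminus -` A" "1 - a - int M" M, OF this]
  have "card (uminus -` A \<inter> uminus -` E \<inter> {1 - a - int M..<1 - a - int M + int M}) \<le> \<eta> * real M + real L"
    by simp
  moreover have "bij_betw uminus (uminus -` A \<inter> uminus -` E \<inter> {1 - a - int M..<1 - a - int M + int M})
      (A \<inter> E \<inter> {a..<a + int M})"
    by (rule bij_betwI[where g = uminus]) auto
  ultimately show ?thesis
    by (simp add: bij_betw_same_card)
qed

definition window_freq :: "int \<Rightarrow> nat \<Rightarrow> int set \<Rightarrow> real" where
  "window_freq a M A = card (A \<inter> {a..<a + int M}) / real M"

lemma window_freq_nonneg: "0 \<le> window_freq a M A"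
  by (simp add: window_freq_def)

lemma window_freq_le_1: "window_freq a M A \<le> 1"
proof -
  have "card (A \<inter> {a..<a + int M}) \<le> card {a..<a + int M}"
    by (intro card_mono) auto
  then show ?thesis by (cases M) (simp_all add: window_freq_def divide_le_eq_1)
qed

lemma window_freq_mono: "A \<subseteq> B \<Longrightarrow> window_freq a M A \<le> window_freq a M B"
  by (auto simp: window_freq_def intro!: divide_right_mono card_mono)

lemma window_freq_Un: "window_freq a M (A \<union> B) \<le> window_freq a M A + window_freq a M B"
proof -
  have "card ((A \<union> B) \<inter> {a..<a + int M}) \<le> card (A \<inter> {a..<a + int M}) + card (B \<inter> {a..<a + int M})"
    using card_Un_le[of "A \<inter> {a..<a + int M}" "B \<inter> {a..<a + int M}"] by (simp add: Int_Un_distrib2)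
  then show ?thesis
    unfolding window_freq_def add_divide_distrib[symmetric] by (intro divide_right_mono) linarith+
qed

lemma window_freq_UN:
  assumes "finite I"
  shows "window_freq a M (\<Union>i\<in>I. A i) \<le> (\<Sum>i\<in>I. window_freq a M (A i))"
  using assms
proof induction
  case empty
  then show ?case by (simp add: window_freq_def)
next
  case (insert i I)
  then show ?case using window_freq_Un[of a M "A i" "\<Union>i\<in>I. A i"] by simp
qed

lemma window_freq_Diff:
  assumes "A \<subseteq> B"
  shows "window_freq a M (B - A) = window_freq a M B - window_freq a M A"
proof -
  have "(B - A) \<inter> {a..<a + int M} = (B \<inter> {a..<a + int M}) - (A \<inter> {a..<a + int M})"
    by auto
  moreover have "card (A \<inter> {a..<a + int M}) \<le> card (B \<inter> {a..<a + int M})"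
    using assms by (intro card_mono) auto
  moreover have "card (B \<inter> {a..<a + int M} - A \<inter> {a..<a + int M}) =
      card (B \<inter> {a..<a + int M}) - card (A \<inter> {a..<a + int M})"
    using assms by (intro card_Diff_subset) auto
  ultimately have "real (card ((B - A) \<inter> {a..<a + int M})) =
      real (card (B \<inter> {a..<a + int M})) - real (card (A \<inter> {a..<a + int M}))"
    by (simp add: of_nat_diff)
  then show ?thesis
    by (simp add: window_freq_def diff_divide_distrib)
qed

text \<open>
  The counterpart of the maximal ergodic inequality: the part of \<open>A\<close> from which some segment of bounded
  length sees \<open>A\<close> rarely is itself rare.
\<close>

lemma window_freq_greedy:
  assumes \<eta>: "0 \<le> \<eta>" and s: "s = 1 \<or> s = -1" and M: "M > 0"
    and sparse: "\<And>m. m \<in> E \<Longrightarrow> \<exists>N\<in>{1..L}. card {k\<in>{..<N}. m + s * int k \<in> A} \<le> \<eta> * real N"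
  shows "window_freq a M (A \<inter> E) \<le> \<eta> + real L / real M"
  using divide_right_mono[OF card_greedy[OF \<eta> s sparse, where a = a and M = M], where c = "real M"] M
  by (simp add: window_freq_def add_divide_distrib)

section \<open>Frequently recurrent points in compact balls\<close>

text \<open>
  The norm supplies a countable base and \<open>\<tau>\<close> supplies compactness.  Continuity of \<open>T\<close> is required on
  balls only, since in this form it passes to the inverse \<open>T'\<close>.
\<close>

locale compact_ball_dynamics =
  fixes \<tau> :: "'p::real_normed_vector topology" and X :: "'p set" and T T' :: "'p \<Rightarrow> 'p"
  assumes Hausdorff: "Hausdorff_space \<tau>"
    and topspace_UNIV: "topspace \<tau> = UNIV"
    and compact_balls: "compactin \<tau> (X \<inter> cball a r)"
    and separable: "\<exists>D. countable D \<and> D \<subseteq> X \<and> X \<subseteq> closure D"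
    and maps: "x \<in> X \<Longrightarrow> T x \<in> X" "x \<in> X \<Longrightarrow> T' x \<in> X"
    and inverses: "x \<in> X \<Longrightarrow> T' (T x) = x" "x \<in> X \<Longrightarrow> T (T' x) = x"
    and bounded: "\<exists>K. \<forall>x\<in>X. norm (T x) \<le> K * norm x" "\<exists>K. \<forall>x\<in>X. norm (T' x) \<le> K * norm x"
    and continuous_on_balls: "continuous_map (subtopology \<tau> (X \<inter> cball 0 r)) \<tau> T"
begin

lemma funpow_maps: "x \<in> X \<Longrightarrow> (T ^^ n) x \<in> X" "x \<in> X \<Longrightarrow> (T' ^^ n) x \<in> X"
  by (induction n) (auto simp: maps)

lemma maps_ball:
  obtains R where "T ` (X \<inter> cball 0 r) \<subseteq> X \<inter> cball 0 R"
proof -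
  obtain K where K: "\<forall>x\<in>X. norm (T x) \<le> K * norm x" using bounded by auto
  have "T ` (X \<inter> cball 0 r) \<subseteq> X \<inter> cball 0 (\<bar>K\<bar> * r)"
  proof (rule image_subsetI)
    fix x assume "x \<in> X \<inter> cball 0 r"
    then have x: "x \<in> X" "norm x \<le> r" by auto
    have "norm (T x) \<le> K * norm x" using K x by blast
    also have "\<dots> \<le> \<bar>K\<bar> * norm x" by (intro mult_right_mono) auto
    also have "\<dots> \<le> \<bar>K\<bar> * r" using x by (intro mult_left_mono) auto
    finally show "T x \<in> X \<inter> cball 0 (\<bar>K\<bar> * r)" using x maps by simp
  qed
  then show ?thesis by (rule that)
qed

text \<open>
  On a ball, \<open>T\<close> is a continuous injection of a compact space into a Hausdorff space, hence a
  homeomorphism onto its image.  Thus \<open>T'\<close> is continuous on balls as well, and \<open>T\<close> and \<open>T'\<close> play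
  symmetric roles.
\<close>

lemma inverse_dynamics: "compact_ball_dynamics \<tau> X T' T"
proof
  fix r
  let ?U = "X \<inter> cball 0 r"
  obtain K where K: "\<forall>x\<in>X. norm (T' x) \<le> K * norm x" using bounded by auto
  let ?B = "X \<inter> cball 0 (\<bar>K\<bar> * r)"
  have sub: "T' ` ?U \<subseteq> ?B"
  proof (rule image_subsetI)
    fix x assume "x \<in> X \<inter> cball 0 r"
    then have x: "x \<in> X" "norm x \<le> r" by auto
    have "norm (T' x) \<le> K * norm x" using K x by blast
    also have "\<dots> \<le> \<bar>K\<bar> * norm x" by (intro mult_right_mono) auto
    also have "\<dots> \<le> \<bar>K\<bar> * r" using x by (intro mult_left_mono) auto
    finally show "T' x \<in> ?B" using x maps by simp
  qed
  show "continuous_map (subtopology \<tau> ?U) \<tau> T'"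
    unfolding continuous_map_closedin
  proof (intro conjI allI impI ballI)
    fix C assume C: "closedin \<tau> C"
    have "compactin \<tau> (?B \<inter> C)"
      using compact_Int_closedin[OF compact_balls C] .
    then have "compactin (subtopology \<tau> ?B) (?B \<inter> C)"
      by (auto simp: compactin_subtopology)
    then have "compactin \<tau> (T ` (?B \<inter> C))"
      by (rule image_compactin[OF _ continuous_on_balls])
    then have cl: "closedin \<tau> (T ` (?B \<inter> C))"
      by (rule compactin_imp_closedin[OF Hausdorff])
    have "{x \<in> topspace (subtopology \<tau> ?U). T' x \<in> C} = T ` (?B \<inter> C) \<inter> ?U"
    proof (intro set_eqI iffI)
      fix x assume "x \<in> {x \<in> topspace (subtopology \<tau> ?U). T' x \<in> C}"
      then have x: "x \<in> ?U" "T' x \<in> C" by auto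
      have "T' x \<in> ?B" using sub x(1) by (rule subsetD[OF _ imageI])
      from imageI[OF IntI[OF this x(2)]] have "T (T' x) \<in> T ` (?B \<inter> C)" .
      then show "x \<in> T ` (?B \<inter> C) \<inter> ?U" using x(1) inverses(2)[of x] by simp
    next
      fix x assume "x \<in> T ` (?B \<inter> C) \<inter> ?U"
      then show "x \<in> {x \<in> topspace (subtopology \<tau> ?U). T' x \<in> C}"
        using inverses topspace_UNIV by auto
    qed
    then show "closedin (subtopology \<tau> ?U) {x \<in> topspace (subtopology \<tau> ?U). T' x \<in> C}"
      using cl by (auto simp: closedin_subtopology)
  qed (simp add: topspace_UNIV)
qed (use Hausdorff topspace_UNIV compact_balls separable maps inverses bounded in auto)

lemma continuous_funpow:
  "continuous_map (subtopology \<tau> (X \<inter> cball a r)) \<tau> (T ^^ n)"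
proof -
  have *: "continuous_map (subtopology \<tau> (X \<inter> cball 0 R)) \<tau> (T ^^ n)" for R
  proof (induction n arbitrary: R)
    case 0
    then show ?case by (simp add: continuous_map_from_subtopology id_def)
  next
    case (Suc n)
    obtain R' where R': "T ` (X \<inter> cball 0 R) \<subseteq> X \<inter> cball 0 R'" by (rule maps_ball)
    have "continuous_map (subtopology \<tau> (X \<inter> cball 0 R)) (subtopology \<tau> (X \<inter> cball 0 R')) T"
      using R' topspace_UNIV by (auto simp: continuous_map_in_subtopology continuous_on_balls)
    from continuous_map_compose[OF this Suc] show ?case
      by (simp add: funpow_Suc_right o_def del: funpow.simps)
  qed
  have "X \<inter> cball a r \<subseteq> X \<inter> cball 0 (norm a + r)"
  proof clarsimp
    fix x assume "dist a x \<le> r"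
    then show "norm x \<le> norm a + r"
      using norm_triangle_ineq[of a "x - a"] by (simp add: dist_norm norm_minus_commute)
  qed
  from continuous_map_from_subtopology_mono[OF * this] show ?thesis .
qed

lemma openin_many_visits:
  assumes P: "openin \<tau> P"
  shows "openin (subtopology \<tau> (X \<inter> cball a r))
    {z \<in> X \<inter> cball a r. real (card {k\<in>{..<N}. (T ^^ k) z \<in> P}) > c}"
proof -
  let ?U = "X \<inter> cball a r"
  let ?\<S> = "{S. S \<subseteq> {..<N} \<and> real (card S) > c}"
  have pre: "openin (subtopology \<tau> ?U) {z \<in> ?U. (T ^^ k) z \<in> P}" for k
    using openin_continuous_map_preimage[OF continuous_funpow P, of a r k] topspace_UNIV by simp
  have S: "openin (subtopology \<tau> ?U) (?U \<inter> (\<Inter>k\<in>S. {z \<in> ?U. (T ^^ k) z \<in> P}))" if "S \<subseteq> {..<N}" for S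
  proof (cases "S = {}")
    case True
    then show ?thesis using openin_topspace[of "subtopology \<tau> ?U"] topspace_UNIV by simp
  next
    case False
    have fin: "finite S" using that finite_subset by blast
    have "openin (subtopology \<tau> ?U) (\<Inter>k\<in>S. {z \<in> ?U. (T ^^ k) z \<in> P})"
    proof (rule openin_Inter)
      fix A assume "A \<in> (\<lambda>k. {z \<in> ?U. (T ^^ k) z \<in> P}) ` S"
      then obtain k where "A = {z \<in> ?U. (T ^^ k) z \<in> P}" by (rule imageE)
      then show "openin (subtopology \<tau> ?U) A" using pre[of k] by (simp only:)
    qed (use False fin in auto)
    moreover have "(\<Inter>k\<in>S. {z \<in> ?U. (T ^^ k) z \<in> P}) \<subseteq> ?U" using False by auto
    ultimately show ?thesis by (simp add: Int_absorb1)
  qed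
  have eq: "{z \<in> ?U. real (card {k\<in>{..<N}. (T ^^ k) z \<in> P}) > c}
      = (\<Union>S\<in>?\<S>. ?U \<inter> (\<Inter>k\<in>S. {z \<in> ?U. (T ^^ k) z \<in> P}))" (is "?L = ?R")
  proof (intro set_eqI iffI)
    fix z assume z: "z \<in> ?L"
    let ?S = "{k\<in>{..<N}. (T ^^ k) z \<in> P}"
    have "?S \<in> ?\<S>" using z by auto
    moreover have "z \<in> ?U \<inter> (\<Inter>k\<in>?S. {z \<in> ?U. (T ^^ k) z \<in> P})" using z by auto
    ultimately show "z \<in> ?R" by (rule UN_I)
  next
    fix z assume "z \<in> ?R"
    then obtain S where S: "S \<subseteq> {..<N}" "real (card S) > c" "z \<in> ?U" "\<forall>k\<in>S. (T ^^ k) z \<in> P"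
      by auto
    then have "card S \<le> card {k\<in>{..<N}. (T ^^ k) z \<in> P}"
      by (intro card_mono) auto
    then show "z \<in> ?L" using S by auto
  qed
  show ?thesis
    unfolding eq
  proof (rule openin_Union)
    fix A assume "A \<in> (\<lambda>S. ?U \<inter> (\<Inter>k\<in>S. {z \<in> ?U. (T ^^ k) z \<in> P})) ` ?\<S>"
    then obtain R where "R \<in> ?\<S>" "A = ?U \<inter> (\<Inter>k\<in>R. {z \<in> ?U. (T ^^ k) z \<in> P})"
      by (rule imageE)
    then show "openin (subtopology \<tau> ?U) A" using S[of R] by (simp only: mem_Collect_eq)
  qed
qed

text \<open>
  For \<open>z \<in> V\<close>, that a segment of its orbit rarely visits \<open>V\<close> is witnessed by frequent visits to the open
  sets \<open>P l\<close>, so it is an open condition.  Visits to \<open>G l\<close> exclude visits to \<open>P l\<close>, hence by the greedy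
  count the orbit \<open>orb\<close> is rarely in \<open>G l\<close> at a point satisfying the condition with \<open>P l\<close>.

  The difficulty is that the condition weakens as \<open>l\<close> grows, so that no single \<open>G l\<close> works for all points
  of the bad set.  The remedy is to use a neighbourhood \<open>G (i l)\<close> whose frequency exceeds the limiting
  frequency by at most \<open>\<eta> (1/2)^(l+1)\<close>: in a finite union all the \<open>G (i l)\<close> can then be replaced by one
  smaller \<open>G q\<close>, and the errors add up to at most \<open>\<eta>\<close>.  This is where genuine convergence of the
  frequencies is used.  The sign \<open>s\<close> allows the lemma to be applied to \<open>T\<close> and to its inverse along the
  same two-sided orbit.
\<close>

lemma poorly_visited_cover:
  fixes G P :: "nat \<Rightarrow> 'p set" and orb :: "int \<Rightarrow> 'p" and a :: "nat \<Rightarrow> int" and M :: "nat \<Rightarrow> nat"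
  assumes G: "\<And>l. openin \<tau> (G l)" "\<And>l. V \<subseteq> G l" "decseq G"
    and P: "\<And>l. openin \<tau> (P l)" "X - V \<subseteq> (\<Union>l. P l)" "incseq P"
    and disj: "\<And>l. G l \<inter> P l = {}"
    and s: "s = 1 \<or> s = -1"
    and orb: "\<And>n. orb n \<in> X" "\<And>n. T (orb n) = orb (n + s)"
    and M: "filterlim M at_top sequentially"
    and conv: "\<And>l. convergent (\<lambda>j. window_freq (a j) (M j) (orb -` G l))"
    and \<eta>: "\<eta> > 0"
  obtains W :: "nat \<Rightarrow> 'p set" where "\<And>l. openin (subtopology \<tau> (X \<inter> cball c r)) (W l)"
    and "{z \<in> X \<inter> cball c r \<inter> V. \<exists>N. card {k\<in>{..<N}. (T ^^ k) z \<in> V} < \<eta> * real N} \<subseteq> (\<Union>l. W l)"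
    and "\<And>L. \<forall>\<^sub>F j in sequentially. window_freq (a j) (M j) (orb -` (\<Union>l\<le>L. W l)) \<le> 3 * \<eta>"
proof -
  let ?U = "X \<inter> cball c r"
  define f where "f l j = window_freq (a j) (M j) (orb -` G l)" for l j
  define d where "d l = lim (f l)" for l
  have lim: "f l \<longlonglongrightarrow> d l" for l
    using conv[of l] by (simp add: f_def[abs_def] d_def convergent_LIMSEQ_iff)
  have "decseq d"
  proof (rule decseq_SucI, rule LIMSEQ_le[OF lim lim])
    fix n
    have "f (Suc n) j \<le> f n j" for j
      using decseq_SucD[OF G(3), of n] unfolding f_def by (intro window_freq_mono) auto
    then show "\<exists>N. \<forall>m\<ge>N. f (Suc n) m \<le> f n m" by blast
  qed
  moreover have "0 \<le> d l" for l
    by (rule LIMSEQ_le_const[OF lim]) (auto simp: f_def window_freq_nonneg)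
  ultimately obtain e where e: "d \<longlonglongrightarrow> e" "\<And>l. e \<le> d l"
    using decseq_convergent[of d 0] by blast
  have "\<exists>i. d i \<le> e + \<eta> * (1/2) ^ Suc l" for l
  proof -
    have "\<forall>\<^sub>F i in sequentially. d i < e + \<eta> * (1/2) ^ Suc l"
      using \<eta> by (intro order_tendstoD(2)[OF e(1)]) simp
    then show ?thesis by (meson eventually_happens less_imp_le sequentially_bot trivial_limit_sequentially)
  qed
  then obtain i where i: "\<And>l. d (i l) \<le> e + \<eta> * (1/2) ^ Suc l" by metis
  define H where "H l = {z. \<exists>N\<in>{1..l}. card {k\<in>{..<N}. (T ^^ k) z \<in> P l} > (1 - \<eta>) * real N}" for l
  define W where "W l = ?U \<inter> G (i l) \<inter> H l" for l
  have orb_funpow: "(T ^^ k) (orb n) = orb (n + s * int k)" for k n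
    by (induction k) (simp_all add: orb algebra_simps)
  show ?thesis
  proof (rule that[of W])
    fix l
    have "W l = (\<Union>N\<in>{1..l}. {z \<in> ?U. card {k\<in>{..<N}. (T ^^ k) z \<in> P l} > (1 - \<eta>) * real N})
        \<inter> (?U \<inter> G (i l))"
      by (auto simp: W_def H_def)
    also have "openin (subtopology \<tau> ?U) \<dots>"
    proof (rule openin_Int)
      show "openin (subtopology \<tau> ?U) (?U \<inter> G (i l))"
        by (rule openin_subtopology_Int2[OF G(1)])
      show "openin (subtopology \<tau> ?U)
          (\<Union>N\<in>{1..l}. {z \<in> ?U. card {k\<in>{..<N}. (T ^^ k) z \<in> P l} > (1 - \<eta>) * real N})"
      proof (rule openin_Union)
        fix A assume "A \<in> (\<lambda>N. {z \<in> ?U. card {k\<in>{..<N}. (T ^^ k) z \<in> P l} > (1 - \<eta>) * real N}) ` {1..l}"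
        then obtain N where "A = {z \<in> ?U. card {k\<in>{..<N}. (T ^^ k) z \<in> P l} > (1 - \<eta>) * real N}"
          by (rule imageE)
        then show "openin (subtopology \<tau> ?U) A"
          using openin_many_visits[OF P(1), of c r "(1 - \<eta>) * real N" N l] by (simp only:)
      qed
    qed
    finally show "openin (subtopology \<tau> ?U) (W l)" .
  next
    show "{z \<in> ?U \<inter> V. \<exists>N. card {k\<in>{..<N}. (T ^^ k) z \<in> V} < \<eta> * real N} \<subseteq> (\<Union>l. W l)"
    proof
      fix z assume "z \<in> {z \<in> ?U \<inter> V. \<exists>N. card {k\<in>{..<N}. (T ^^ k) z \<in> V} < \<eta> * real N}"
      then obtain N where z: "z \<in> X" "z \<in> cball c r" "z \<in> V"
        and N: "card {k\<in>{..<N}. (T ^^ k) z \<in> V} < \<eta> * real N"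
        by blast
      have "N \<ge> 1" using N by (cases N) auto
      define S where "S = {k\<in>{..<N}. (T ^^ k) z \<notin> V}"
      have "\<forall>k\<in>S. \<exists>l. (T ^^ k) z \<in> P l"
        using P(2) funpow_maps(1)[OF z(1)] unfolding S_def by blast
      then obtain g where g: "\<And>k. k \<in> S \<Longrightarrow> (T ^^ k) z \<in> P (g k)" by metis
      \<comment> \<open>Finitely many times occur, so one index bounds the length \<open>N\<close> and all indices \<open>g k\<close>.\<close>
      define l where "l = N + (\<Sum>k\<in>S. g k)"
      have "finite S" by (simp add: S_def)
      then have "g k \<le> l" if "k \<in> S" for k
        using member_le_sum[of k S g] that by (simp add: l_def)
      then have "(T ^^ k) z \<in> P l" if "k \<in> S" for k
        using g[OF that] incseqD[OF P(3), of "g k" l] that by blast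
      then have "S \<subseteq> {k\<in>{..<N}. (T ^^ k) z \<in> P l}"
        unfolding S_def by blast
      then have "card S \<le> card {k\<in>{..<N}. (T ^^ k) z \<in> P l}"
        by (intro card_mono) auto
      moreover have "card {k\<in>{..<N}. (T ^^ k) z \<in> V} + card S = N"
      proof -
        have "card ({k\<in>{..<N}. (T ^^ k) z \<in> V} \<union> S) = card {k\<in>{..<N}. (T ^^ k) z \<in> V} + card S"
          by (intro card_Un_disjoint) (auto simp: S_def)
        moreover have "{k\<in>{..<N}. (T ^^ k) z \<in> V} \<union> S = {..<N}" by (auto simp: S_def)
        ultimately show ?thesis by simp
      qed
      ultimately have "card {k\<in>{..<N}. (T ^^ k) z \<in> P l} > (1 - \<eta>) * real N"
        using N by (simp add: algebra_simps)
      moreover have "N \<in> {1..l}" using \<open>N \<ge> 1\<close> by (simp add: l_def)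
      ultimately have "z \<in> H l"
        unfolding H_def mem_Collect_eq by (rule bexI)
      moreover have "z \<in> ?U \<inter> G (i l)"
        using z G(2)[of "i l"] by auto
      ultimately have "z \<in> W l"
        unfolding W_def by (rule IntI[rotated])
      then show "z \<in> (\<Union>l. W l)" by blast
    qed
  next
    fix L
    \<comment> \<open>A crude common upper bound of \<open>L\<close> and of all \<open>i l\<close> with \<open>l \<le> L\<close>.\<close>
    define q where "q = L + (\<Sum>l\<le>L. i l)"
    have q: "i l \<le> q" if "l \<le> L" for l
    proof -
      have "i l \<le> (\<Sum>l\<le>L. i l)" by (rule member_le_sum) (use that in auto)
      then show ?thesis unfolding q_def by linarith
    qed
    define A where "A = orb -` G q"
    define E where "E = {m. \<exists>N\<in>{1..L}. card {k\<in>{..<N}. m + s * int k \<in> A} \<le> \<eta> * real N}"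
    have "orb -` (\<Union>l\<le>L. W l) \<subseteq> (\<Union>l\<in>{..L}. orb -` G (i l) - A) \<union> (A \<inter> E)"
    proof
      fix m assume "m \<in> orb -` (\<Union>l\<le>L. W l)"
      then obtain l where l: "l \<le> L" "orb m \<in> G (i l)" "orb m \<in> H l" by (auto simp: W_def)
      obtain N where N: "N \<in> {1..l}" "card {k\<in>{..<N}. (T ^^ k) (orb m) \<in> P l} > (1 - \<eta>) * real N"
        using l by (auto simp: H_def)
      let ?v = "{k\<in>{..<N}. m + s * int k \<in> A}"
      let ?p = "{k\<in>{..<N}. (T ^^ k) (orb m) \<in> P l}"
      have "P l \<subseteq> P q" using l incseqD[OF P(3), of l q] by (simp add: q_def)
      then have "?v \<inter> ?p = {}" using disj[of q] by (auto simp: A_def orb_funpow)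
      then have "card ?v + card ?p = card (?v \<union> ?p)" by (intro card_Un_disjoint[symmetric]) auto
      also have "\<dots> \<le> card {..<N}" by (intro card_mono) auto
      finally have "card ?v \<le> \<eta> * real N" using N by (simp add: algebra_simps)
      then have "m \<in> E" using N l by (force simp: E_def)
      then show "m \<in> (\<Union>l\<in>{..L}. orb -` G (i l) - A) \<union> (A \<inter> E)" using l by blast
    qed
    then have split: "window_freq (a j) (M j) (orb -` (\<Union>l\<le>L. W l)) \<le>
        (\<Sum>l\<le>L. window_freq (a j) (M j) (orb -` G (i l) - A)) + window_freq (a j) (M j) (A \<inter> E)" for j
      by (rule order_trans[OF window_freq_mono
            order_trans[OF window_freq_Un add_right_mono[OF window_freq_UN[OF finite_atMost]]]])
    have diffs: "(\<Sum>l\<le>L. window_freq (a j) (M j) (orb -` G (i l) - A)) = (\<Sum>l\<le>L. f (i l) j - f q j)" for j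
    proof (rule sum.cong[OF refl])
      fix l assume "l \<in> {..L}"
      then have "A \<subseteq> orb -` G (i l)" using decseqD[OF G(3) q] by (auto simp: A_def)
      from window_freq_Diff[OF this]
      show "window_freq (a j) (M j) (orb -` G (i l) - A) = f (i l) j - f q j"
        by (simp add: f_def A_def)
    qed
    have "\<forall>\<^sub>F j in sequentially. M j > 0"
      using M eventually_gt_at_top[of 0] unfolding filterlim_iff by blast
    then have ev: "\<forall>\<^sub>F j in sequentially. window_freq (a j) (M j) (orb -` (\<Union>l\<le>L. W l))
        \<le> (\<Sum>l\<le>L. f (i l) j - f q j) + (\<eta> + real L / real (M j))"
    proof eventually_elim
      case (elim j)
      have "window_freq (a j) (M j) (A \<inter> E) \<le> \<eta> + real L / real (M j)"
        by (rule window_freq_greedy[OF less_imp_le[OF \<eta>] s elim]) (simp add: E_def)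
      then show ?case using split[of j] diffs[of j] by linarith
    qed
    \<comment> \<open>The limit of this bound is at most \<open>2 * \<eta>\<close>, so the bound is eventually below \<open>3 * \<eta>\<close>.\<close>
    have "(\<lambda>j. real L / real (M j)) \<longlonglongrightarrow> 0"
      by (rule tendsto_divide_0[OF tendsto_const filterlim_at_top_imp_at_infinity
            [OF filterlim_compose[OF filterlim_real_sequentially M]]])
    then have lim2: "(\<lambda>j. (\<Sum>l\<le>L. f (i l) j - f q j) + (\<eta> + real L / real (M j)))
        \<longlonglongrightarrow> (\<Sum>l\<le>L. d (i l) - d q) + (\<eta> + 0)"
      by (intro tendsto_intros lim)
    have "(\<Sum>l\<le>L. d (i l) - d q) \<le> (\<Sum>l\<le>L. \<eta> * (1/2) ^ Suc l)"
    proof (rule sum_mono)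
      fix l
      show "d (i l) - d q \<le> \<eta> * (1/2) ^ Suc l" using i[of l] e(2)[of q] by linarith
    qed
    also have "\<dots> = \<eta> * (\<Sum>l\<le>L. (1/2) ^ Suc l)"
      by (simp add: sum_distrib_left)
    also have "(\<Sum>l\<le>L. (1/2::real) ^ Suc l) = 1 - (1/2) ^ Suc L"
      by (induction L) (simp_all add: field_simps)
    also have "\<eta> * (1 - (1/2) ^ Suc L) \<le> \<eta>"
      using \<eta> by (simp add: mult_left_le)
    finally have "(\<Sum>l\<le>L. d (i l) - d q) + (\<eta> + 0) < 3 * \<eta>" using \<eta> by simp
    from order_tendstoD(2)[OF lim2 this] ev
    show "\<forall>\<^sub>F j in sequentially. window_freq (a j) (M j) (orb -` (\<Union>l\<le>L. W l)) \<le> 3 * \<eta>"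
      by eventually_elim simp
  qed
qed

end

lemma lower_density_pos:
  assumes \<eta>: "\<eta> > 0" and visits: "\<And>N. card {k\<in>{..<N}. k \<in> A} \<ge> \<eta> * real N" and "A \<subseteq> B"
  shows "lower_density B > 0"
proof -
  have "ereal \<eta> \<le> lower_density B"
    unfolding lower_density_def
  proof (rule Liminf_bounded, rule always_eventually, rule allI)
    fix N
    have "\<eta> * real (N + 1) \<le> card {k\<in>{..<N + 1}. k \<in> A}" by (rule visits)
    also have "card {k\<in>{..<N + 1}. k \<in> A} \<le> card (B \<inter> {0..N})"
      using \<open>A \<subseteq> B\<close> by (intro card_mono) auto
    finally show "ereal \<eta> \<le> ereal (real (card (B \<inter> {0..N})) / real (N + 1))"
      by (simp add: field_simps)
  qed
  moreover have "0 < ereal \<eta>" using \<eta> by simp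
  ultimately show ?thesis by (rule less_le_trans[rotated])
qed

text \<open>
  The windows are placed in the integers because the backward orbit will be followed as well.
\<close>

lemma upper_Banach_density_windows:
  assumes "upper_Banach_density A > 0"
  obtains \<delta> and a :: "nat \<Rightarrow> int" and M :: "nat \<Rightarrow> nat"
  where "\<delta> > 0" "filterlim M at_top sequentially" "\<And>j. \<delta> \<le> window_freq (a j) (M j) (int ` A)"
proof -
  let ?f = "\<lambda>N m. ereal (real (card (A \<inter> {m..m + N})) / real (N + 1))"
  obtain \<delta> where \<delta>: "0 < ereal \<delta>" "ereal \<delta> < upper_Banach_density A"
    using ereal_dense2[OF assms] by auto
  have "\<exists>N m. j \<le> N \<and> ereal \<delta> < ?f N m" for j
  proof (rule ccontr)
    assume "\<not> ?thesis"
    then have "\<forall>N\<ge>j. (SUP m. ?f N m) \<le> ereal \<delta>"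
      by (auto intro!: SUP_least simp: not_less)
    then have "upper_Banach_density A \<le> ereal \<delta>"
      unfolding upper_Banach_density_def by (intro Limsup_bounded) (auto simp: eventually_sequentially)
    then show False using \<delta> by simp
  qed
  then obtain N m where Nm: "\<And>j. j \<le> N j" "\<And>j. ereal \<delta> < ?f (N j) (m j)" by metis
  show ?thesis
  proof (rule that[of \<delta> "\<lambda>j. N j + 1" "\<lambda>j. int (m j)"])
    show "filterlim (\<lambda>j. N j + 1) at_top sequentially"
      by (rule filterlim_at_top_mono[OF filterlim_ident]) (simp add: Nm(1) le_SucI)
    fix j
    have "int ` A \<inter> {int (m j)..<int (m j) + int (N j + 1)} = int ` (A \<inter> {m j..m j + N j})"
    proof (intro set_eqI iffI)
      fix x assume "x \<in> int ` A \<inter> {int (m j)..<int (m j) + int (N j + 1)}"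
      then obtain n where "x = int n" "n \<in> A \<inter> {m j..m j + N j}" by auto
      then show "x \<in> int ` (A \<inter> {m j..m j + N j})" by (rule image_eqI)
    qed auto
    then show "\<delta> \<le> window_freq (int (m j)) (N j + 1) (int ` A)"
      using Nm(2)[of j] by (simp add: window_freq_def card_image)
  qed (use \<delta> in auto)
qed

lemma sum_geometric_half_le: "(\<Sum>k\<le>n. (1/2::real) ^ k) \<le> 2"
proof -
  have "(\<Sum>k\<le>n. (1/2::real) ^ k) = 2 - (1/2) ^ n"
    by (induction n) (simp_all add: field_simps)
  then show ?thesis by simp
qed

context compact_ball_dynamics
begin

text \<open>
  The closed balls with rational radii and centres in a countable dense set.  The last property says that
  the complement of each is a countable union of others; it makes each ball the trace
  on \<open>X\<close> of a countable intersection of \<open>\<tau>\<close>-open sets.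
\<close>

lemma ball_basis:
  assumes "X \<noteq> {}"
  obtains B :: "nat \<Rightarrow> 'p set"
  where "\<And>k. compactin \<tau> (B k)"
    and "\<And>y e. y \<in> X \<Longrightarrow> e > 0 \<Longrightarrow> \<exists>k. y \<in> B k \<and> B k \<subseteq> ball y e"
    and "\<And>k. X - B k \<subseteq> (\<Union>j\<in>{j. B j \<inter> B k = {}}. B j)"
proof -
  obtain D where D: "countable D" "D \<subseteq> X" "X \<subseteq> closure D" using separable by auto
  define \<B> where "\<B> = (\<lambda>(d, q). X \<inter> cball d (real_of_rat q)) ` (D \<times> {q. 0 < q})"
  have "countable \<B>" unfolding \<B>_def using D(1) by (intro countable_image countable_SIGMA) auto
  have "D \<noteq> {}" using D assms by auto
  then obtain d0 where "d0 \<in> D" by auto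
  then have "\<B> \<noteq> {}" unfolding \<B>_def using zero_less_one[where 'a = rat] by blast
  have small: "\<exists>A\<in>\<B>. y \<in> A \<and> A \<subseteq> ball y e" if y: "y \<in> X" and e: "e > 0" for y e
  proof -
    obtain d where d: "d \<in> D" "dist d y < e / 3"
      using y D(3) e closure_approachable[of y D] by (metis divide_pos_pos subsetD zero_less_numeral)
    obtain q where q: "e / 3 < real_of_rat q" "real_of_rat q < e / 2"
      using of_rat_dense[of "e / 3" "e / 2"] e by auto
    have "0 < real_of_rat q" using q e by linarith
    then have "X \<inter> cball d (real_of_rat q) \<in> \<B>" unfolding \<B>_def using d by auto
    moreover have "y \<in> X \<inter> cball d (real_of_rat q)" using y d q by auto
    moreover have "X \<inter> cball d (real_of_rat q) \<subseteq> ball y e"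
    proof
      fix z assume "z \<in> X \<inter> cball d (real_of_rat q)"
      then have "dist d z \<le> real_of_rat q" by simp
      then show "z \<in> ball y e" using dist_triangle[of y z d] d q by (simp add: dist_commute)
    qed
    ultimately show ?thesis by blast
  qed
  have outside: "\<exists>A'\<in>\<B>. z \<in> A' \<and> A' \<inter> A = {}" if A: "A \<in> \<B>" and z: "z \<in> X - A" for A z
  proof -
    obtain d q where dq: "A = X \<inter> cball d (real_of_rat q)" using A by (auto simp: \<B>_def)
    then have "dist d z > real_of_rat q" using z by auto
    then obtain A' where A': "A' \<in> \<B>" "z \<in> A'" "A' \<subseteq> ball z (dist d z - real_of_rat q)"
      using small[of z "dist d z - real_of_rat q"] z by auto
    have "A' \<inter> A = {}"
    proof (rule equals0I)
      fix w assume "w \<in> A' \<inter> A"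
      then have "dist z w < dist d z - real_of_rat q" "dist d w \<le> real_of_rat q"
        using A' dq by auto
      then show False using dist_triangle2[of d z w] by linarith
    qed
    with A' show ?thesis by blast
  qed
  let ?B = "from_nat_into \<B>"
  have into: "?B k \<in> \<B>" for k using from_nat_into[OF \<open>\<B> \<noteq> {}\<close>] .
  have onto: "\<exists>k. A = ?B k" if "A \<in> \<B>" for A
    using from_nat_into_surj[OF \<open>countable \<B>\<close> that] by metis
  show ?thesis
  proof (rule that[of ?B])
    show "compactin \<tau> (?B k)" for k
      using into[of k] compact_balls by (auto simp: \<B>_def)
    show "\<exists>k. y \<in> ?B k \<and> ?B k \<subseteq> ball y e" if "y \<in> X" "e > 0" for y e
      using small[OF that] onto by metis
    show "X - ?B k \<subseteq> (\<Union>j\<in>{j. ?B j \<inter> ?B k = {}}. ?B j)" for k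
    proof
      fix z assume "z \<in> X - ?B k"
      from outside[OF into this] obtain A where "A \<in> \<B>" "z \<in> A" "A \<inter> ?B k = {}" by blast
      moreover obtain j where "A = ?B j" using onto[OF \<open>A \<in> \<B>\<close>] ..
      ultimately show "z \<in> (\<Union>j\<in>{j. ?B j \<inter> ?B k = {}}. ?B j)" by blast
    qed
  qed
qed

text \<open>
  Separate \<open>V\<close> by disjoint open sets from each of the compact sets \<open>B j\<close> that make up its complement, and
  take finite intersections and unions.
\<close>

lemma separating_neighbourhoods:
  fixes B :: "nat \<Rightarrow> 'p set"
  assumes comp: "\<And>k. compactin \<tau> (B k)" and V: "compactin \<tau> V"
    and outside: "X - V \<subseteq> (\<Union>j\<in>{j. B j \<inter> V = {}}. B j)"
  obtains G P :: "nat \<Rightarrow> 'p set"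
  where "\<And>l. openin \<tau> (G l)" "\<And>l. V \<subseteq> G l" "decseq G"
    and "\<And>l. openin \<tau> (P l)" "X - V \<subseteq> (\<Union>l. P l)" "incseq P"
    and "\<And>l. G l \<inter> P l = {}"
proof -
  have "\<exists>g p. openin \<tau> g \<and> openin \<tau> p \<and> V \<subseteq> g \<and> g \<inter> p = {} \<and> (B j \<inter> V = {} \<longrightarrow> B j \<subseteq> p)" for j
  proof (cases "B j \<inter> V = {}")
    case True
    then obtain p g where "openin \<tau> p" "openin \<tau> g" "B j \<subseteq> p" "V \<subseteq> g" "disjnt p g"
      using Hausdorff_space_compact_separation[OF Hausdorff comp V, of j] by (auto simp: disjnt_def)
    then show ?thesis by (intro exI[of _ g] exI[of _ p]) (auto simp: disjnt_def)
  next
    case False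
    then show ?thesis
      using openin_topspace[of \<tau>] topspace_UNIV by (intro exI[of _ UNIV] exI[of _ "{}"]) auto
  qed
  then obtain g p where gp: "\<And>j. openin \<tau> (g j)" "\<And>j. openin \<tau> (p j)" "\<And>j. V \<subseteq> g j"
      "\<And>j. g j \<inter> p j = {}" "\<And>j. B j \<inter> V = {} \<Longrightarrow> B j \<subseteq> p j"
    by metis
  show ?thesis
  proof (rule that[of "\<lambda>l. \<Inter>j\<le>l. g j" "\<lambda>l. \<Union>j\<le>l. p j"])
    show "openin \<tau> (\<Inter>j\<le>l. g j)" for l by (rule openin_Inter) (auto simp: gp)
    show "V \<subseteq> (\<Inter>j\<le>l. g j)" for l using gp(3) by blast
    show "decseq (\<lambda>l. \<Inter>j\<le>l. g j)" by (intro decseq_SucI) (auto simp: atMost_Suc)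
    show "openin \<tau> (\<Union>j\<le>l. p j)" for l by (rule openin_Union) (auto simp: gp)
    show "X - V \<subseteq> (\<Union>l. \<Union>j\<le>l. p j)"
    proof
      fix z assume "z \<in> X - V"
      then obtain j where "B j \<inter> V = {}" "z \<in> B j" using outside by blast
      then have "z \<in> p j" using gp(5) by blast
      then show "z \<in> (\<Union>l. \<Union>j\<le>l. p j)" by blast
    qed
    show "incseq (\<lambda>l. \<Union>j\<le>l. p j)" by (intro incseq_SucI) (auto simp: atMost_Suc)
    show "(\<Inter>j\<le>l. g j) \<inter> (\<Union>j\<le>l. p j) = {}" for l using gp(4) by blast
  qed
qed

definition orbit :: "'p \<Rightarrow> int \<Rightarrow> 'p" where
  "orbit x n = (if 0 \<le> n then (T ^^ nat n) x else (T' ^^ nat (- n)) x)"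

lemma orbit_in: "x \<in> X \<Longrightarrow> orbit x n \<in> X"
  by (simp add: orbit_def funpow_maps)

lemma orbit_forward:
  assumes x: "x \<in> X"
  shows "T (orbit x n) = orbit x (n + 1)"
proof (cases "0 \<le> n")
  case True
  then show ?thesis by (simp add: orbit_def nat_add_distrib)
next
  case False
  define k where "k = nat (- n - 1)"
  have "nat (- n) = Suc k" using False by (simp add: k_def)
  then have "T (orbit x n) = T (T' ((T' ^^ k) x))"
    using False by (simp add: orbit_def)
  also have "\<dots> = (T' ^^ k) x" using inverses(2)[OF funpow_maps(2)[OF x]] .
  also have "\<dots> = orbit x (n + 1)"
  proof (cases "n = - 1")
    case False
    then have "\<not> 0 \<le> n + 1" "nat (- (n + 1)) = k" using \<open>\<not> 0 \<le> n\<close> by (simp_all add: k_def)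
    then show ?thesis by (simp add: orbit_def)
  qed (simp add: orbit_def k_def)
  finally show ?thesis .
qed

lemma orbit_backward:
  assumes x: "x \<in> X"
  shows "T' (orbit x n) = orbit x (n + - 1)"
  using orbit_forward[OF x, of "n - 1"] inverses(1)[OF orbit_in[OF x, of "n - 1"]] by simp

text \<open>
  The budget: the bad set of \<open>B k\<close> is allotted \<open>6 * \<eta> k\<close> (three for each direction of time), and
  \<open>\<eta> k = \<delta> / 24 * (1/2) ^ k\<close> makes the total at most \<open>\<delta> / 2\<close>, whereas the orbit spends a proportion
  at least \<open>\<delta>\<close> of each window in the ball.
\<close>

theorem frequently_recurrent_near:
  assumes x: "x \<in> X" and returns: "upper_Banach_density {n. (T ^^ n) x \<in> cball x r} > 0"
  obtains y where "y \<in> X" "y \<in> cball x r"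
    and "\<And>e. e > 0 \<Longrightarrow> lower_density {n. (T ^^ n) y \<in> ball y e} > 0"
    and "\<And>e. e > 0 \<Longrightarrow> lower_density {n. (T' ^^ n) y \<in> ball y e} > 0"
proof -
  interpret inv: compact_ball_dynamics \<tau> X T' T by (rule inverse_dynamics)
  let ?U = "X \<inter> cball x r"
  obtain \<delta> and a0 :: "nat \<Rightarrow> int" and M0 :: "nat \<Rightarrow> nat" where \<delta>: "\<delta> > 0"
    and M0: "filterlim M0 at_top sequentially"
    and dense0: "\<And>j. \<delta> \<le> window_freq (a0 j) (M0 j) (int ` {n. (T ^^ n) x \<in> cball x r})"
    using upper_Banach_density_windows[OF returns] by metis
  have sub: "int ` {n. (T ^^ n) x \<in> cball x r} \<subseteq> orbit x -` ?U"
    using funpow_maps x by (auto simp: orbit_def)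
  obtain B :: "nat \<Rightarrow> 'p set" where B: "\<And>k. compactin \<tau> (B k)"
      "\<And>y e. y \<in> X \<Longrightarrow> e > 0 \<Longrightarrow> \<exists>k. y \<in> B k \<and> B k \<subseteq> ball y e"
      "\<And>k. X - B k \<subseteq> (\<Union>j\<in>{j. B j \<inter> B k = {}}. B j)"
    using ball_basis x by blast
  have "\<exists>G P :: nat \<Rightarrow> 'p set. (\<forall>l. openin \<tau> (G l)) \<and> (\<forall>l. B k \<subseteq> G l) \<and> decseq G \<and>
      (\<forall>l. openin \<tau> (P l)) \<and> X - B k \<subseteq> (\<Union>l. P l) \<and> incseq P \<and> (\<forall>l. G l \<inter> P l = {})" for k
    by (rule separating_neighbourhoods[OF B(1) B(1) B(3), of k]) blast
  then obtain G P :: "nat \<Rightarrow> nat \<Rightarrow> 'p set" where GP: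
      "\<And>k l. openin \<tau> (G k l)" "\<And>k l. B k \<subseteq> G k l" "\<And>k. decseq (G k)"
      "\<And>k l. openin \<tau> (P k l)" "\<And>k. X - B k \<subseteq> (\<Union>l. P k l)" "\<And>k. incseq (P k)"
      "\<And>k l. G k l \<inter> P k l = {}"
    by metis
  obtain \<rho> where \<rho>: "strict_mono \<rho>"
      "\<forall>i. convergent (\<lambda>j. (case i of (k, l) \<Rightarrow> window_freq (a0 (\<rho> j)) (M0 (\<rho> j)) (orbit x -` G k l)))"
    using common_convergent_subsequence
      [of "\<lambda>j (k, l). window_freq (a0 j) (M0 j) (orbit x -` G k l)"]
    by (auto simp: window_freq_nonneg window_freq_le_1 split: prod.splits)
  define a where "a j = a0 (\<rho> j)" for j
  define M where "M j = M0 (\<rho> j)" for j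
  have conv: "convergent (\<lambda>j. window_freq (a j) (M j) (orbit x -` G k l))" for k l
    using \<rho>(2)[rule_format, of "(k, l)"] by (simp add: a_def M_def)
  have M: "filterlim M at_top sequentially"
    unfolding M_def by (rule filterlim_compose[OF M0 filterlim_subseq[OF \<rho>(1)]])
  have dense: "\<delta> \<le> window_freq (a j) (M j) (orbit x -` ?U)" for j
    using order_trans[OF dense0 window_freq_mono[OF sub]] by (simp add: a_def M_def)
  define \<eta> where "\<eta> k = \<delta> / 24 * (1/2) ^ k" for k :: nat
  have \<eta>: "\<eta> k > 0" for k using \<delta> by (simp add: \<eta>_def)
  define covers where "covers k W \<longleftrightarrow> (\<forall>l. openin (subtopology \<tau> ?U) (W l)) \<and>
      {z \<in> ?U \<inter> B k. \<exists>N. card {i\<in>{..<N}. (T ^^ i) z \<in> B k} < \<eta> k * real N} \<subseteq> (\<Union>l. W l) \<and>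
      {z \<in> ?U \<inter> B k. \<exists>N. card {i\<in>{..<N}. (T' ^^ i) z \<in> B k} < \<eta> k * real N} \<subseteq> (\<Union>l. W l) \<and>
      (\<forall>L. \<forall>\<^sub>F j in sequentially.
        window_freq (a j) (M j) (orbit x -` (\<Union>l\<le>L. W l)) \<le> 6 * \<eta> k)"
    for k and W :: "nat \<Rightarrow> 'p set"
  have "\<exists>W. covers k W" for k
  proof -
    obtain W1 :: "nat \<Rightarrow> 'p set" where W1: "\<And>l. openin (subtopology \<tau> ?U) (W1 l)"
      "{z \<in> ?U \<inter> B k. \<exists>N. card {i\<in>{..<N}. (T ^^ i) z \<in> B k} < \<eta> k * real N} \<subseteq> (\<Union>l. W1 l)"
      "\<And>L. \<forall>\<^sub>F j in sequentially. window_freq (a j) (M j) (orbit x -` (\<Union>l\<le>L. W1 l)) \<le> 3 * \<eta> k"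
      by (rule poorly_visited_cover[OF GP(1-7) disjI1[OF refl] orbit_in[OF x] orbit_forward[OF x]
            M conv \<eta>[of k], of x r]) blast
    obtain W2 :: "nat \<Rightarrow> 'p set" where W2: "\<And>l. openin (subtopology \<tau> ?U) (W2 l)"
      "{z \<in> ?U \<inter> B k. \<exists>N. card {i\<in>{..<N}. (T' ^^ i) z \<in> B k} < \<eta> k * real N} \<subseteq> (\<Union>l. W2 l)"
      "\<And>L. \<forall>\<^sub>F j in sequentially. window_freq (a j) (M j) (orbit x -` (\<Union>l\<le>L. W2 l)) \<le> 3 * \<eta> k"
      by (rule inv.poorly_visited_cover[OF GP(1-7) disjI2[OF refl] orbit_in[OF x] orbit_backward[OF x]
            M conv \<eta>[of k], of x r]) blast
    let ?W = "\<lambda>l. W1 l \<union> W2 l"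
    have freq: "\<forall>\<^sub>F j in sequentially. window_freq (a j) (M j) (orbit x -` (\<Union>l\<le>L. ?W l)) \<le> 6 * \<eta> k" for L
      using W1(3)[of L] W2(3)[of L]
    proof eventually_elim
      case (elim j)
      have "orbit x -` (\<Union>l\<le>L. ?W l) = orbit x -` (\<Union>l\<le>L. W1 l) \<union> orbit x -` (\<Union>l\<le>L. W2 l)"
        by auto
      then show ?case
        using elim window_freq_Un[of "a j" "M j" "orbit x -` (\<Union>l\<le>L. W1 l)" "orbit x -` (\<Union>l\<le>L. W2 l)"]
        by simp
    qed
    have sub: "(\<Union>l. W1 l) \<subseteq> (\<Union>l. ?W l)" "(\<Union>l. W2 l) \<subseteq> (\<Union>l. ?W l)" by auto
    have bad: "{z \<in> ?U \<inter> B k. \<exists>N. card {i\<in>{..<N}. (T ^^ i) z \<in> B k} < \<eta> k * real N} \<subseteq> (\<Union>l. ?W l)"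
      "{z \<in> ?U \<inter> B k. \<exists>N. card {i\<in>{..<N}. (T' ^^ i) z \<in> B k} < \<eta> k * real N} \<subseteq> (\<Union>l. ?W l)"
      by (rule order_trans[OF W1(2) sub(1)], rule order_trans[OF W2(2) sub(2)])
    have op: "openin (subtopology \<tau> ?U) (?W l)" for l
      using W1(1) W2(1) by (rule openin_Un)
    show ?thesis
      unfolding covers_def by (rule exI[of _ ?W], intro conjI allI op bad freq)
  qed
  then obtain W where "\<And>k. covers k (W k)" by metis
  then have W: "\<And>k l. openin (subtopology \<tau> ?U) (W k l)"
      "\<And>k. {z \<in> ?U \<inter> B k. \<exists>N. card {i\<in>{..<N}. (T ^^ i) z \<in> B k} < \<eta> k * real N} \<subseteq> (\<Union>l. W k l)"
      "\<And>k. {z \<in> ?U \<inter> B k. \<exists>N. card {i\<in>{..<N}. (T' ^^ i) z \<in> B k} < \<eta> k * real N} \<subseteq> (\<Union>l. W k l)"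
      "\<And>k L. \<forall>\<^sub>F j in sequentially. window_freq (a j) (M j) (orbit x -` (\<Union>l\<le>L. W k l)) \<le> 6 * \<eta> k"
    unfolding covers_def by simp_all
  have "\<not> ?U \<subseteq> (\<Union>k. \<Union>l. W k l)"
  proof
    assume cover: "?U \<subseteq> (\<Union>k. \<Union>l. W k l)"
    let ?\<W> = "range (\<lambda>(k, l). W k l)"
    have "compactin (subtopology \<tau> ?U) ?U"
      using compact_balls by (simp add: compactin_subtopology)
    moreover have "?U \<subseteq> \<Union>?\<W>" using cover by fastforce
    moreover have "\<forall>A\<in>?\<W>. openin (subtopology \<tau> ?U) A" using W(1) by auto
    ultimately obtain \<F> where \<F>: "finite \<F>" "\<F> \<subseteq> ?\<W>" "?U \<subseteq> \<Union>\<F>"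
      unfolding compactin_def by meson
    obtain S where S: "finite S" "\<F> = (\<lambda>(k, l). W k l) ` S"
      using finite_subset_image[OF \<F>(1,2)] by blast
    obtain n where n: "\<forall>i\<in>fst ` S \<union> snd ` S. i \<le> n"
      using S(1) finite_nat_set_iff_bounded_le by (metis finite_UnI finite_imageI)
    have "?U \<subseteq> (\<Union>k\<le>n. \<Union>l\<le>n. W k l)"
    proof
      fix z assume "z \<in> ?U"
      then have "z \<in> (\<Union>i\<in>S. W (fst i) (snd i))"
        using \<F>(3) unfolding S(2) case_prod_unfold by (rule rev_subsetD)
      then obtain i where "i \<in> S" "z \<in> W (fst i) (snd i)" by (rule UN_E)
      moreover from \<open>i \<in> S\<close> have "fst i \<le> n" "snd i \<le> n" using n by simp_all
      ultimately show "z \<in> (\<Union>k\<le>n. \<Union>l\<le>n. W k l)" by blast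
    qed
    from vimage_mono[OF this]
    have sub: "orbit x -` ?U \<subseteq> (\<Union>k\<in>{..n}. orbit x -` (\<Union>l\<le>n. W k l))"
      unfolding vimage_UN .
    have "\<forall>\<^sub>F j in sequentially. \<forall>k\<in>{..n}.
        window_freq (a j) (M j) (orbit x -` (\<Union>l\<le>n. W k l)) \<le> 6 * \<eta> k"
      by (rule eventually_ball_finite) (auto simp: W(4))
    then obtain j where j: "\<And>k. k \<le> n \<Longrightarrow>
        window_freq (a j) (M j) (orbit x -` (\<Union>l\<le>n. W k l)) \<le> 6 * \<eta> k"
      by (auto simp: eventually_sequentially)
    have "\<delta> \<le> window_freq (a j) (M j) (orbit x -` ?U)" by (rule dense)
    also have "\<dots> \<le> (\<Sum>k\<le>n. window_freq (a j) (M j) (orbit x -` (\<Union>l\<le>n. W k l)))"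
      by (rule order_trans[OF window_freq_mono[OF sub] window_freq_UN]) simp
    also have "\<dots> \<le> (\<Sum>k\<le>n. \<delta> / 4 * (1/2) ^ k)"
    proof (rule sum_mono)
      fix k assume "k \<in> {..n}"
      then show "window_freq (a j) (M j) (orbit x -` (\<Union>l\<le>n. W k l)) \<le> \<delta> / 4 * (1/2) ^ k"
        using j[of k] by (simp add: \<eta>_def)
    qed
    also have "\<dots> = \<delta> / 4 * (\<Sum>k\<le>n. (1/2) ^ k)" by (rule sum_distrib_left[symmetric])
    also have "\<dots> \<le> \<delta> / 4 * 2" using \<delta> sum_geometric_half_le by (intro mult_left_mono) auto
    finally show False using \<delta> by linarith
  qed
  then obtain y where y: "y \<in> ?U" "\<And>k. y \<notin> (\<Union>l. W k l)" by blast
  have visits: "\<eta> k * real N \<le> card {i\<in>{..<N}. i \<in> {n. (T ^^ n) y \<in> B k}}"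
      "\<eta> k * real N \<le> card {i\<in>{..<N}. i \<in> {n. (T' ^^ n) y \<in> B k}}" if "y \<in> B k" for k N
    using W(2,3)[of k] y that by (auto simp: not_less[symmetric])
  show ?thesis
  proof (rule that)
    fix e :: real assume "e > 0"
    then obtain k where k: "y \<in> B k" "B k \<subseteq> ball y e" using B(2)[of y e] y(1) by auto
    show "lower_density {n. (T ^^ n) y \<in> ball y e} > 0"
      by (rule lower_density_pos[OF \<eta> visits(1)[OF k(1)]]) (use k in auto)
    show "lower_density {n. (T' ^^ n) y \<in> ball y e} > 0"
      by (rule lower_density_pos[OF \<eta> visits(2)[OF k(1)]]) (use k in auto)
  qed (use y in auto)
qed

end

section \<open>From visits to balls to recurrence\<close>

lemma lower_density_mono:
  assumes "A \<subseteq> B"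
  shows "lower_density A \<le> lower_density B"
  unfolding lower_density_def
proof (rule Liminf_mono, rule always_eventually, rule allI)
  fix N
  have "card (A \<inter> {0..N}) \<le> card (B \<inter> {0..N})" using assms by (intro card_mono) auto
  then show "ereal (card (A \<inter> {0..N}) / real (N + 1)) \<le> ereal (card (B \<inter> {0..N}) / real (N + 1))"
    by (auto intro!: divide_right_mono)
qed

lemma upper_Banach_density_mono:
  assumes "A \<subseteq> B"
  shows "upper_Banach_density A \<le> upper_Banach_density B"
  unfolding upper_Banach_density_def
proof (rule Limsup_mono, rule always_eventually, rule allI, rule SUP_mono')
  fix N m
  have "card (A \<inter> {m..m + N}) \<le> card (B \<inter> {m..m + N})" using assms by (intro card_mono) auto
  then show "ereal (card (A \<inter> {m..m + N}) / real (N + 1)) \<le> ereal (card (B \<inter> {m..m + N}) / real (N + 1))"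
    by (auto intro!: divide_right_mono)
qed

lemma lower_density_le_upper_Banach_density: "lower_density A \<le> upper_Banach_density A"
proof -
  let ?f = "\<lambda>N. ereal (card (A \<inter> {0..N}) / real (N + 1))"
  have "lower_density A \<le> limsup ?f"
    unfolding lower_density_def by (rule Liminf_le_Limsup) simp
  also have "\<dots> \<le> upper_Banach_density A"
    unfolding upper_Banach_density_def
  proof (rule Limsup_mono, rule always_eventually, rule allI)
    fix N
    show "?f N \<le> (SUP m. ereal (card (A \<inter> {m..m + N}) / real (N + 1)))"
      by (rule SUP_upper2[of 0]) auto
  qed
  finally show ?thesis .
qed

lemma FRec_subset_RRec: "FRec X T \<subseteq> RRec X T"
  using lower_density_le_upper_Banach_density by (fastforce simp: FRec_def RRec_def dest: less_le_trans)

lemma funpow_in: "T ` X \<subseteq> X \<Longrightarrow> x \<in> X \<Longrightarrow> (T ^^ n) x \<in> X"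
  by (induction n) auto

lemma FRecI:
  fixes X :: "'p::metric_space set"
  assumes X: "T ` X \<subseteq> X" "y \<in> X"
    and visits: "\<And>e. e > 0 \<Longrightarrow> lower_density {n. (T ^^ n) y \<in> ball y e} > 0"
  shows "y \<in> FRec X T"
  unfolding FRec_def
proof (intro CollectI conjI allI impI)
  fix U assume "nhd_in X y U"
  then obtain W where W: "openin (top_of_set X) W" "y \<in> W" "W \<subseteq> U"
    by (auto simp: nhd_in_def)
  then obtain e where e: "e > 0" "\<And>z. z \<in> X \<Longrightarrow> dist z y < e \<Longrightarrow> z \<in> W"
    unfolding openin_euclidean_subtopology_iff by blast
  have "{n. (T ^^ n) y \<in> ball y e} \<subseteq> return_set T y U"
    using e(2) W(3) funpow_in[OF X] by (auto simp: return_set_def dist_commute)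
  from less_le_trans[OF visits[OF e(1)] lower_density_mono[OF this]]
  show "0 < lower_density (return_set T y U)" .
qed (rule X(2))

lemma RRecD:
  fixes X :: "'p::metric_space set"
  assumes "x \<in> RRec X T" "e > 0"
  shows "upper_Banach_density {n. (T ^^ n) x \<in> cball x e} > 0"
proof -
  have x: "x \<in> X" using assms by (simp add: RRec_def)
  have "openin (top_of_set X) (X \<inter> ball x e)" by (simp add: openin_open_Int)
  then have "nhd_in X x (X \<inter> ball x e)"
    using assms(2) x unfolding nhd_in_def by (intro conjI exI[of _ "X \<inter> ball x e"]) auto
  then have "upper_Banach_density (return_set T x (X \<inter> ball x e)) > 0"
    using assms(1) by (simp add: RRec_def)
  moreover have "return_set T x (X \<inter> ball x e) \<subseteq> {n. (T ^^ n) x \<in> cball x e}"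
    by (auto simp: return_set_def)
  ultimately show ?thesis
    using upper_Banach_density_mono less_le_trans by blast
qed

text \<open>
  The hypotheses put \<open>RRec X T\<close> and \<open>RRec X T'\<close>, the largest of the sets involved, into the closure of
  \<open>FRec X T \<inter> FRec X T'\<close>, the smallest one.
\<close>

lemma recurrence_of_inverse:
  fixes X :: "'p::real_normed_vector set"
  assumes near: "\<And>x e. x \<in> RRec X T \<Longrightarrow> e > 0 \<Longrightarrow> \<exists>y\<in>FRec X T \<inter> FRec X T'. y \<in> cball x e"
    and near': "\<And>x e. x \<in> RRec X T' \<Longrightarrow> e > 0 \<Longrightarrow> \<exists>y\<in>FRec X T \<inter> FRec X T'. y \<in> cball x e"
  shows "closure (RRec X T) = closure (FRec X T) \<and>
    closure (FRec X T) = closure (FRec X T') \<and>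
    closure (FRec X T') = closure (RRec X T') \<and>
    (reiteratively_recurrent X T \<longleftrightarrow> reiteratively_recurrent X T') \<and>
    (frequently_recurrent X T \<longleftrightarrow> frequently_recurrent X T') \<and>
    (reiteratively_recurrent X T \<longleftrightarrow> frequently_recurrent X T) \<and>
    (RRec X T - {0} \<noteq> {} \<longrightarrow> (FRec X T \<inter> FRec X T') - {0} \<noteq> {})"
proof -
  let ?F = "FRec X T \<inter> FRec X T'"
  have dense: "R \<subseteq> closure ?F"
    if *: "\<And>x e. x \<in> R \<Longrightarrow> e > 0 \<Longrightarrow> \<exists>y\<in>?F. y \<in> cball x e" for R
  proof
    fix x assume "x \<in> R"
    then have "\<exists>y\<in>?F. dist y x \<le> e" if "e > 0" for e
      using *[OF \<open>x \<in> R\<close> that] by (simp add: dist_commute[of _ x])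
    then show "x \<in> closure ?F"
      unfolding closure_approachable_le by blast
  qed
  have RRec: "RRec X T \<subseteq> closure ?F" "RRec X T' \<subseteq> closure ?F"
    by (rule dense[OF near], assumption+, rule dense[OF near'], assumption+)
  have sandwich: "closure A = closure ?F" if "?F \<subseteq> A" "A \<subseteq> closure ?F" for A
    using closure_mono[OF that(1)] closure_minimal[OF that(2) closed_closure] by (rule antisym[rotated])
  have "FRec X T \<subseteq> RRec X T" "FRec X T' \<subseteq> RRec X T'"
    by (rule FRec_subset_RRec)+
  then have cl: "closure (RRec X T) = closure ?F" "closure (FRec X T) = closure ?F"
    "closure (RRec X T') = closure ?F" "closure (FRec X T') = closure ?F"
    using RRec by (auto intro!: sandwich)
  moreover have "?F - {0} \<noteq> {}" if nz: "RRec X T - {0} \<noteq> {}"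
  proof -
    obtain x where x: "x \<in> RRec X T" "x \<noteq> 0" using nz by auto
    then obtain y where y: "y \<in> ?F" "y \<in> cball x (norm x / 2)" using near[of x "norm x / 2"] by auto
    then have "y \<noteq> 0" using x by auto
    with y show ?thesis by auto
  qed
  ultimately show ?thesis
    by (simp add: reiteratively_recurrent_def frequently_recurrent_def)
qed

context compact_ball_dynamics
begin

lemma FRec_near_RRec:
  assumes "x \<in> RRec X T" "e > 0"
  shows "\<exists>y\<in>FRec X T \<inter> FRec X T'. y \<in> cball x e"
proof -
  have x: "x \<in> X" using assms by (simp add: RRec_def)
  obtain y where "y \<in> X" "y \<in> cball x e"
    "\<And>e. e > 0 \<Longrightarrow> lower_density {n. (T ^^ n) y \<in> ball y e} > 0"
    "\<And>e. e > 0 \<Longrightarrow> lower_density {n. (T' ^^ n) y \<in> ball y e} > 0"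
    using frequently_recurrent_near[OF x RRecD[OF assms]] by metis
  moreover have "T ` X \<subseteq> X" "T' ` X \<subseteq> X" using maps by auto
  ultimately show ?thesis by (intro bexI[of _ y] IntI FRecI) auto
qed

end

section \<open>Topologies of pointwise convergence\<close>

text \<open>
  The coarsest topology for which all coordinates \<open>\<lambda>x. e x i\<close> are continuous.  With \<open>e\<close> the evaluation
  of functionals at vectors it is the weak-star topology, and with the roles of functionals and
  vectors exchanged it is the weak topology.
\<close>

definition evaluation_topology :: "('p \<Rightarrow> 'i \<Rightarrow> 'k::topological_space) \<Rightarrow> 'p topology" where
  "evaluation_topology e = pullback_topology UNIV e euclidean"

lemma openin_evaluation_topology:
  "openin (evaluation_topology e) S \<longleftrightarrow> (\<exists>U. open U \<and> S = e -` U)"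
  by (simp add: evaluation_topology_def openin_pullback_topology)

lemma topspace_evaluation_topology [simp]: "topspace (evaluation_topology e) = UNIV"
  by (simp add: evaluation_topology_def topspace_pullback_topology)

lemma Hausdorff_evaluation_topology:
  fixes e :: "'p \<Rightarrow> 'i \<Rightarrow> 'k::metric_space"
  assumes "inj e"
  shows "Hausdorff_space (evaluation_topology e)"
  unfolding Hausdorff_space_def
proof (intro allI impI)
  fix x y assume xy: "x \<in> topspace (evaluation_topology e) \<and> y \<in> topspace (evaluation_topology e) \<and> x \<noteq> y"
  then have "e x \<noteq> e y" using assms by (auto dest: injD)
  moreover have "Hausdorff_space (euclidean :: ('i \<Rightarrow> 'k) topology)"
    using Hausdorff_space_product_topology[of "\<lambda>_::'i. euclidean :: 'k topology" UNIV]
    by (simp add: euclidean_product_topology Hausdorff_space_euclidean)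
  ultimately obtain U V where "open U" "open V" "e x \<in> U" "e y \<in> V" "disjnt U V"
    unfolding Hausdorff_space_def by (metis UNIV_I open_openin topspace_euclidean)
  then show "\<exists>U V. openin (evaluation_topology e) U \<and> openin (evaluation_topology e) V \<and>
      x \<in> U \<and> y \<in> V \<and> disjnt U V"
    unfolding openin_evaluation_topology
    by (intro exI[of _ "e -` U"] exI[of _ "e -` V"]) (auto simp: disjnt_def)
qed

text \<open>
  Tychonoff's theorem, as in the proof of Banach--Alaoglu: \<open>e ` A\<close> is a closed subset of a product of
  compact balls.
\<close>

lemma compactin_evaluation_topology:
  fixes e :: "'p \<Rightarrow> 'i \<Rightarrow> 'k::euclidean_space"
  assumes closed: "closed (e ` A)" and bounded: "\<And>x i. x \<in> A \<Longrightarrow> norm (e x i) \<le> b i"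
  shows "compactin (evaluation_topology e) A"
proof -
  let ?K = "PiE UNIV (\<lambda>i. cball (0::'k) (b i))"
  have "compactin (product_topology (\<lambda>_. euclidean) UNIV) ?K"
    by (simp add: compactin_PiE)
  then have "compact ?K" by (simp add: euclidean_product_topology)
  moreover have "e ` A \<subseteq> ?K" using bounded by auto
  ultimately have "compact (e ` A)"
    using closed by (metis compact_Int_closed inf.absorb_iff2)
  show ?thesis
    unfolding compactin_def
  proof (intro conjI allI impI)
    fix \<U> assume \<U>: "Ball \<U> (openin (evaluation_topology e)) \<and> A \<subseteq> \<Union>\<U>"
    let ?\<V> = "{V. open V \<and> e -` V \<in> \<U>}"
    have cover: "e ` A \<subseteq> \<Union>?\<V>"
    proof (rule image_subsetI)
      fix x assume "x \<in> A"
      then obtain S where S: "S \<in> \<U>" "x \<in> S" using \<U> by blast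
      then obtain V where "open V" "S = e -` V" using \<U> openin_evaluation_topology by metis
      then show "e x \<in> \<Union>?\<V>" using S by auto
    qed
    have "open V" if "V \<in> ?\<V>" for V using that by simp
    then obtain \<F> where \<F>: "\<F> \<subseteq> ?\<V>" "finite \<F>" "e ` A \<subseteq> \<Union>\<F>"
      by (rule compactE[OF \<open>compact (e ` A)\<close> cover])
    have "A \<subseteq> \<Union>((\<lambda>V. e -` V) ` \<F>)" using \<F>(3) by auto
    then show "\<exists>\<F>. finite \<F> \<and> \<F> \<subseteq> \<U> \<and> A \<subseteq> \<Union>\<F>"
      using \<F>(1,2) by (intro exI[of _ "(\<lambda>V. e -` V) ` \<F>"]) auto
  qed simp
qed

lemma continuous_map_evaluation_topology:
  assumes "\<And>i. \<exists>j. \<forall>x\<in>A. e (T x) i = e x j"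
  shows "continuous_map (subtopology (evaluation_topology e) A) (evaluation_topology e) T"
proof -
  obtain g where g: "\<And>i x. x \<in> A \<Longrightarrow> e (T x) i = e x (g i)" using assms by metis
  have cont: "continuous_on UNIV (\<lambda>\<phi> i. \<phi> (g i))"
    by (intro continuous_on_coordinatewise_then_product continuous_on_product_coordinates)
  show ?thesis
    unfolding continuous_map_def
  proof (intro conjI allI impI)
    fix S assume "openin (evaluation_topology e) S"
    then obtain U where U: "open U" "S = e -` U" by (auto simp: openin_evaluation_topology)
    have "open ((\<lambda>\<phi> i. \<phi> (g i)) -` U)" using open_vimage[OF U(1) cont] .
    then have "openin (evaluation_topology e) (e -` ((\<lambda>\<phi> i. \<phi> (g i)) -` U))"
      unfolding openin_evaluation_topology by blast
    moreover have "{x \<in> topspace (subtopology (evaluation_topology e) A). T x \<in> S} =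
        e -` ((\<lambda>\<phi> i. \<phi> (g i)) -` U) \<inter> A"
    proof -
      have "e (T x) = (\<lambda>i. e x (g i))" if "x \<in> A" for x using g[OF that] by auto
      then show ?thesis unfolding U(2) by auto
    qed
    ultimately show "openin (subtopology (evaluation_topology e) A)
        {x \<in> topspace (subtopology (evaluation_topology e) A). T x \<in> S}"
      by (auto simp: openin_subtopology)
  qed simp
qed

section \<open>Dual spaces\<close>

text \<open>
  The functions \<open>blinfun_apply f\<close> with \<open>f\<close> in the ball are exactly those that satisfy a family of equations
  and inequalities, each of which involves finitely many values only and is therefore closed under
  pointwise convergence.
\<close>

lemma compactin_dual_ball:
  fixes s :: "'k::{real_normed_field, euclidean_space} \<Rightarrow> 'y::real_normed_vector \<Rightarrow> 'y"
  assumes "normed_space_over s"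
  shows "compactin (evaluation_topology blinfun_apply) (dual_space s \<inter> cball a r)"
proof (rule compactin_evaluation_topology)
  interpret normed_space_over s by fact
  show "norm (blinfun_apply f y) \<le> (norm a + r) * norm y" if "f \<in> dual_space s \<inter> cball a r" for f y
  proof -
    have "norm f \<le> norm a + r"
      using that norm_triangle_ineq[of a "f - a"] by (simp add: dist_norm norm_minus_commute)
    then show ?thesis
      using norm_blinfun[of f y] by (meson mult_right_mono norm_ge_zero order_trans)
  qed
  show "closed (blinfun_apply ` (dual_space s \<inter> cball a r))"
  proof (cases "r \<ge> 0")
    case True
    have "blinfun_apply ` (dual_space s \<inter> cball a r) = {\<phi>. (\<forall>x y. \<phi> (x + y) = \<phi> x + \<phi> y) \<and>
        (\<forall>c x. \<phi> (s c x) = c * \<phi> x) \<and> (\<forall>x. norm (\<phi> x - blinfun_apply a x) \<le> r * norm x)}"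
      (is "?L = ?R")
    proof (intro set_eqI iffI)
      fix \<phi> assume "\<phi> \<in> ?L"
      then obtain f where f: "f \<in> dual_space s" "dist a f \<le> r" "\<phi> = blinfun_apply f" by auto
      have "norm (blinfun_apply f x - blinfun_apply a x) \<le> r * norm x" for x
      proof -
        have "norm (blinfun_apply (f - a) x) \<le> norm (f - a) * norm x" by (rule norm_blinfun)
        also have "\<dots> \<le> r * norm x"
          using f(2) by (intro mult_right_mono) (simp_all add: dist_norm norm_minus_commute)
        finally show ?thesis by (simp add: blinfun.diff_left)
      qed
      then show "\<phi> \<in> ?R" using f by (auto simp: dual_space_def blinfun.add_right)
    next
      fix \<phi> assume \<phi>: "\<phi> \<in> ?R"
      have "bounded_linear \<phi>"
      proof
        show "\<phi> (x + y) = \<phi> x + \<phi> y" for x y using \<phi> by blast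
        show "\<phi> (t *\<^sub>R x) = t *\<^sub>R \<phi> x" for t x
        proof -
          have "\<phi> (s (of_real t) x) = of_real t * \<phi> x" using \<phi> by blast
          then show ?thesis by (simp add: scale_of_real scaleR_conv_of_real)
        qed
        have "norm (\<phi> x) \<le> norm x * (r + norm a)" for x
        proof -
          have "norm (\<phi> x) \<le> norm (\<phi> x - blinfun_apply a x) + norm (blinfun_apply a x)"
            using norm_triangle_ineq[of "\<phi> x - blinfun_apply a x" "blinfun_apply a x"] by simp
          also have "\<dots> \<le> r * norm x + norm a * norm x"
            using \<phi> norm_blinfun by (intro add_mono) auto
          finally show ?thesis by (simp add: algebra_simps)
        qed
        then show "\<exists>K. \<forall>x. norm (\<phi> x) \<le> norm x * K" by blast
      qed
      then have app: "blinfun_apply (Blinfun \<phi>) = \<phi>" by (rule bounded_linear_Blinfun_apply)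
      have "norm (Blinfun \<phi> - a) \<le> r"
        using \<phi> True by (intro norm_blinfun_bound) (auto simp: blinfun.diff_left app)
      then have "Blinfun \<phi> \<in> dual_space s \<inter> cball a r"
        using \<phi> by (auto simp: dual_space_def app dist_norm norm_minus_commute)
      then show "\<phi> \<in> ?L" using app by (metis imageI)
    qed
    moreover have "closed ?R"
      by (intro closed_Collect_conj closed_Collect_all closed_Collect_eq closed_Collect_le
          continuous_intros continuous_on_product_coordinates)
    ultimately show ?thesis by simp
  qed simp
qed

text \<open>
  Adjoints are weak-star continuous, because the value of \<open>T f = f o\<^sub>L S\<close> at \<open>y\<close> is the value of \<open>f\<close> at
  \<open>S y\<close>.
\<close>

lemma dual_compact_ball_dynamics:
  fixes s :: "'k::{real_normed_field, euclidean_space} \<Rightarrow> 'y::real_normed_vector \<Rightarrow> 'y"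
  assumes s: "normed_space_over s"
    and sep: "separable_space (top_of_set (dual_space s))"
    and adj: "is_adjoint s T"
    and invt: "invertible_operator_on dual_scale (dual_space s) T"
  shows "compact_ball_dynamics (evaluation_topology blinfun_apply) (dual_space s)
    T (inv_into (dual_space s) T)"
proof
  let ?X = "dual_space s" and ?T' = "inv_into (dual_space s) T"
  have bij: "bij_betw T ?X ?X" using invt by (simp add: invertible_operator_on_def)
  show "Hausdorff_space (evaluation_topology (blinfun_apply :: ('y \<Rightarrow>\<^sub>L 'k) \<Rightarrow> _))"
    by (rule Hausdorff_evaluation_topology) (simp add: inj_def blinfun_apply_inject)
  show "compactin (evaluation_topology blinfun_apply) (?X \<inter> cball a r)" for a r
    by (rule compactin_dual_ball[OF s])
  obtain D where "countable D" "D \<subseteq> ?X" "top_of_set ?X closure_of D = ?X"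
    using sep unfolding separable_space_def by auto
  then show "\<exists>D. countable D \<and> D \<subseteq> ?X \<and> ?X \<subseteq> closure D"
    by (intro exI[of _ D]) (auto simp: closure_of_subtopology Int_absorb1)
  show "f \<in> ?X \<Longrightarrow> T f \<in> ?X" "f \<in> ?X \<Longrightarrow> ?T' f \<in> ?X" for f
    using bij bij_betw_inv_into[OF bij] by (auto dest: bij_betwE)
  show "f \<in> ?X \<Longrightarrow> ?T' (T f) = f" "f \<in> ?X \<Longrightarrow> T (?T' f) = f" for f
    using bij by (auto simp: bij_betw_inv_into_left bij_betw_inv_into_right)
  show "\<exists>K. \<forall>f\<in>?X. norm (T f) \<le> K * norm f" "\<exists>K. \<forall>f\<in>?X. norm (?T' f) \<le> K * norm f"
    using invt by (simp_all add: invertible_operator_on_def operator_on_def bounded_linear_on_def)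
  obtain S where S: "\<And>f. f \<in> ?X \<Longrightarrow> T f = f o\<^sub>L S" using adj by (auto simp: is_adjoint_def)
  show "continuous_map (subtopology (evaluation_topology blinfun_apply) (?X \<inter> cball 0 r))
      (evaluation_topology blinfun_apply) T" for r
  proof (rule continuous_map_evaluation_topology)
    fix y
    show "\<exists>z. \<forall>f\<in>?X \<inter> cball 0 r. blinfun_apply (T f) y = blinfun_apply f z"
      by (intro exI[of _ "blinfun_apply S y"]) (simp add: S)
  qed
qed simp

section \<open>The Hahn--Banach theorem\<close>

definition sublinear :: "('a::real_vector \<Rightarrow> real) \<Rightarrow> bool" where
  "sublinear p \<longleftrightarrow> (\<forall>x y. p (x + y) \<le> p x + p y) \<and> (\<forall>t\<ge>0. \<forall>x. p (t *\<^sub>R x) = t * p x)"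

lemma sublinear_add: "sublinear p \<Longrightarrow> p (x + y) \<le> p x + p y"
  by (simp add: sublinear_def)

lemma sublinear_scale: "sublinear p \<Longrightarrow> 0 \<le> t \<Longrightarrow> p (t *\<^sub>R x) = t * p x"
  by (simp add: sublinear_def)

lemma sublinear_0: "sublinear p \<Longrightarrow> p 0 = 0"
  using sublinear_scale[of p 0 0] by simp

lemma sublinear_minus: "sublinear p \<Longrightarrow> - p (- x) \<le> p x"
  using sublinear_add[of p x "- x"] sublinear_0[of p] by simp

lemma sublinearI:
  assumes add: "\<And>x y. p (x + y) \<le> p x + p y"
    and zero: "p 0 = 0"
    and scale: "\<And>t x. t > 0 \<Longrightarrow> p (t *\<^sub>R x) \<le> t * p x"
  shows "sublinear p"
  unfolding sublinear_def
proof (intro conjI allI impI)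
  fix t :: real and x assume "0 \<le> t"
  show "p (t *\<^sub>R x) = t * p x"
  proof (cases "t = 0")
    case False
    then have t: "t > 0" using \<open>0 \<le> t\<close> by simp
    have "p ((1 / t) *\<^sub>R t *\<^sub>R x) \<le> (1 / t) * p (t *\<^sub>R x)" using t by (intro scale) simp
    then have "t * p x \<le> p (t *\<^sub>R x)" using t by (simp add: field_simps)
    with scale[OF t, of x] show ?thesis by simp
  qed (simp add: zero)
qed (rule add)

text \<open>
  The largest sublinear functional below \<open>p\<close> whose value at \<open>- y\<close> is at most \<open>- p y\<close>.  Passing to it
  makes \<open>p\<close> additive in the direction \<open>y\<close>.
\<close>

definition sublinear_reduct :: "('a::real_vector \<Rightarrow> real) \<Rightarrow> 'a \<Rightarrow> 'a \<Rightarrow> real" where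
  "sublinear_reduct p y x = (INF t\<in>{0..}. p (x + t *\<^sub>R y) - t * p y)"

lemma sublinear_reduct_le:
  assumes p: "sublinear p" and t: "t \<ge> 0"
  shows "sublinear_reduct p y x \<le> p (x + t *\<^sub>R y) - t * p y"
  unfolding sublinear_reduct_def
proof (rule cINF_lower)
  show "bdd_below ((\<lambda>t. p (x + t *\<^sub>R y) - t * p y) ` {0..})"
  proof (rule bdd_belowI2)
    fix t :: real assume "t \<in> {0..}"
    then have "t * p y = p ((x + t *\<^sub>R y) + (- x))" using sublinear_scale[OF p] by simp
    also have "\<dots> \<le> p (x + t *\<^sub>R y) + p (- x)" by (rule sublinear_add[OF p])
    finally show "- p (- x) \<le> p (x + t *\<^sub>R y) - t * p y" by simp
  qed
qed (use t in simp)

lemma le_sublinear_reduct: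
  assumes "\<And>t. t \<ge> 0 \<Longrightarrow> c \<le> p (x + t *\<^sub>R y) - t * p y"
  shows "c \<le> sublinear_reduct p y x"
  unfolding sublinear_reduct_def using assms by (intro cINF_greatest) auto

lemma sublinear_reduct:
  assumes p: "sublinear p"
  shows "sublinear (sublinear_reduct p y)"
proof (rule sublinearI)
  let ?r = "sublinear_reduct p y"
  show "?r (x + x') \<le> ?r x + ?r x'" for x x'
  proof -
    have "?r (x + x') - (p (x' + t' *\<^sub>R y) - t' * p y) \<le> ?r x" if t': "t' \<ge> 0" for t'
    proof (rule le_sublinear_reduct)
      fix t :: real assume t: "t \<ge> 0"
      have "?r (x + x') \<le> p ((x + x') + (t + t') *\<^sub>R y) - (t + t') * p y"
        using t t' by (intro sublinear_reduct_le[OF p]) simp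
      also have "(x + x') + (t + t') *\<^sub>R y = (x + t *\<^sub>R y) + (x' + t' *\<^sub>R y)"
        by (simp add: algebra_simps)
      also have "p \<dots> \<le> p (x + t *\<^sub>R y) + p (x' + t' *\<^sub>R y)" by (rule sublinear_add[OF p])
      finally show "?r (x + x') - (p (x' + t' *\<^sub>R y) - t' * p y) \<le> p (x + t *\<^sub>R y) - t * p y"
        by (simp add: algebra_simps)
    qed
    then have "?r (x + x') - ?r x \<le> p (x' + t' *\<^sub>R y) - t' * p y" if "t' \<ge> 0" for t'
      using that by fastforce
    then have "?r (x + x') - ?r x \<le> ?r x'" by (rule le_sublinear_reduct)
    then show ?thesis by simp
  qed
  show "?r 0 = 0"
    unfolding sublinear_reduct_def using sublinear_scale[OF p] by simp
  show "?r (c *\<^sub>R x) \<le> c * ?r x" if c: "c > 0" for c x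
  proof -
    have "?r (c *\<^sub>R x) / c \<le> ?r x"
    proof (rule le_sublinear_reduct)
      fix t :: real assume t: "t \<ge> 0"
      have "?r (c *\<^sub>R x) \<le> p (c *\<^sub>R x + (c * t) *\<^sub>R y) - (c * t) * p y"
        using c t by (intro sublinear_reduct_le[OF p]) simp
      also have "c *\<^sub>R x + (c * t) *\<^sub>R y = c *\<^sub>R (x + t *\<^sub>R y)" by (simp add: algebra_simps)
      also have "p \<dots> = c * p (x + t *\<^sub>R y)" using c by (simp add: sublinear_scale[OF p])
      finally show "?r (c *\<^sub>R x) / c \<le> p (x + t *\<^sub>R y) - t * p y"
        using c by (simp add: field_simps)
    qed
    then show ?thesis using c by (simp add: field_simps)
  qed
qed

lemma sublinear_reduct_le_self: "sublinear p \<Longrightarrow> sublinear_reduct p y x \<le> p x"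
  using sublinear_reduct_le[of p 0 y x] by simp

lemma sublinear_reduct_minus: "sublinear p \<Longrightarrow> sublinear_reduct p y (- y) \<le> - p y"
  using sublinear_reduct_le[of p 1 y "- y"] by (simp add: sublinear_0)

text \<open>
  Zorn's lemma applies because a sublinear \<open>q \<le> p\<close> satisfies \<open>q x \<ge> - p (- x)\<close>, so pointwise infima of
  chains are finite; they are sublinear because any two members of a chain are comparable.
\<close>

lemma minimal_sublinear_below:
  assumes p: "sublinear p"
  obtains m where "sublinear m" "m \<le> p" "\<And>q. sublinear q \<Longrightarrow> q \<le> m \<Longrightarrow> q = m"
proof -
  let ?A = "{q. sublinear q \<and> q \<le> p}"
  have "\<exists>m\<in>?A. \<forall>q\<in>?A. q \<le> m \<longrightarrow> q = m"
  proof (rule predicate_Zorn)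
    show "partial_order_on ?A (relation_of (\<lambda>q q'. q' \<le> q) ?A)"
      by (rule partial_order_on_relation_ofI) auto
    fix C assume C: "C \<in> Chains (relation_of (\<lambda>q q'. q' \<le> q) ?A)"
    then have A: "C \<subseteq> ?A" by (rule Chains_relation_of)
    have chain: "q \<le> q' \<or> q' \<le> q" if "q \<in> C" "q' \<in> C" for q q'
      using C that unfolding Chains_def relation_of_def by auto
    show "\<exists>u\<in>?A. \<forall>a\<in>C. u \<le> a"
    proof (cases "C = {}")
      case True
      then show ?thesis using p by auto
    next
      case False
      define u where "u x = (INF q\<in>C. q x)" for x
      have bdd: "bdd_below ((\<lambda>q. q x) ` C)" for x
      proof (rule bdd_belowI2)
        fix q assume "q \<in> C"
        then have "sublinear q" "q \<le> p" using A by auto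
        then show "- p (- x) \<le> q x"
          using sublinear_minus[of q x] by (auto simp: le_fun_def intro: order_trans[rotated])
      qed
      have low: "u x \<le> q x" if "q \<in> C" for q x
        unfolding u_def using that by (rule cINF_lower[OF bdd])
      have great: "c \<le> u x" if "\<And>q. q \<in> C \<Longrightarrow> c \<le> q x" for c x
        unfolding u_def using that by (rule cINF_greatest[OF False])
      have "sublinear u"
      proof (rule sublinearI)
        show "u (x + y) \<le> u x + u y" for x y
        proof -
          have "u (x + y) - q' y \<le> u x" if q': "q' \<in> C" for q'
          proof (rule great)
            fix q assume q: "q \<in> C"
            obtain r where r: "r \<in> C" "r \<le> q" "r \<le> q'" using chain[OF q q'] q q' by auto
            have "u (x + y) \<le> r (x + y)" by (rule low[OF r(1)])
            also have "\<dots> \<le> r x + r y" using r A by (intro sublinear_add) auto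
            also have "\<dots> \<le> q x + q' y" using r by (intro add_mono) (auto simp: le_fun_def)
            finally show "u (x + y) - q' y \<le> q x" by simp
          qed
          then have "u (x + y) - u x \<le> q' y" if "q' \<in> C" for q' using that by fastforce
          then have "u (x + y) - u x \<le> u y" by (rule great)
          then show ?thesis by simp
        qed
        obtain q where "q \<in> C" using False by auto
        have zero: "q 0 = 0" if "q \<in> C" for q using that A sublinear_0 by auto
        have "u 0 \<le> 0" using low[OF \<open>q \<in> C\<close>, of 0] zero[OF \<open>q \<in> C\<close>] by simp
        moreover have "0 \<le> u 0"
        proof (rule great)
          fix q assume "q \<in> C"
          then show "0 \<le> q 0" using zero[of q] by simp
        qed
        ultimately show "u 0 = 0" by simp
        show "u (t *\<^sub>R x) \<le> t * u x" if t: "t > 0" for t x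
        proof -
          have "u (t *\<^sub>R x) / t \<le> u x"
          proof (rule great)
            fix q assume q: "q \<in> C"
            have "u (t *\<^sub>R x) \<le> q (t *\<^sub>R x)" by (rule low[OF q])
            also have "\<dots> = t * q x" using q A t by (intro sublinear_scale) auto
            finally show "u (t *\<^sub>R x) / t \<le> q x" using t by (simp add: field_simps)
          qed
          then show ?thesis using t by (simp add: field_simps)
        qed
      qed
      moreover have "u \<le> p"
      proof -
        obtain q where "q \<in> C" using False by auto
        have "u \<le> q" by (rule le_funI) (rule low[OF \<open>q \<in> C\<close>])
        also have "q \<le> p" using A \<open>q \<in> C\<close> by blast
        finally show ?thesis .
      qed
      ultimately show ?thesis using low by (intro bexI[of _ u]) (auto simp: le_fun_def)
    qed
  qed
  then obtain m where m: "sublinear m" "m \<le> p" "\<And>q. sublinear q \<Longrightarrow> q \<le> p \<Longrightarrow> q \<le> m \<Longrightarrow> q = m"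
    by auto
  show ?thesis
    by (rule that[OF m(1,2)]) (rule m(3), auto intro: order_trans[OF _ m(2)])
qed

text \<open>
  A minimal sublinear functional equals all its reducts, hence is odd, and an odd sublinear functional is
  linear.  Choosing it below the reduct of \<open>p\<close> at \<open>z\<close> forces its value at \<open>z\<close> to be \<open>p z\<close>.
\<close>

theorem Hahn_Banach:
  fixes p :: "'a::real_vector \<Rightarrow> real"
  assumes p: "sublinear p"
  obtains g where "linear g" "\<And>x. g x \<le> p x" "g z = p z"
proof -
  obtain g where g: "sublinear g" "g \<le> sublinear_reduct p z"
      "\<And>q. sublinear q \<Longrightarrow> q \<le> g \<Longrightarrow> q = g"
    using minimal_sublinear_below[OF sublinear_reduct[OF p]] by blast
  have minus: "g (- y) = - g y" for y
  proof -
    have "sublinear_reduct g y = g"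
      using sublinear_reduct_le_self[OF g(1)] by (intro g(3) sublinear_reduct[OF g(1)]) (auto simp: le_fun_def)
    then have "g (- y) \<le> - g y" using sublinear_reduct_minus[OF g(1), of y] by simp
    then show ?thesis using sublinear_minus[OF g(1), of y] by simp
  qed
  have le: "g x \<le> p x" for x
    using g(2) sublinear_reduct_le_self[OF p, of z x] by (auto simp: le_fun_def intro: order_trans)
  show ?thesis
  proof (rule that[of g])
    show "linear g"
    proof (rule linearI)
      show "g (x + y) = g x + g y" for x y
        using sublinear_add[OF g(1), of x y] sublinear_add[OF g(1), of "x + y" "- y"] minus by simp
      show "g (t *\<^sub>R x) = t *\<^sub>R g x" for t x
      proof (cases "t \<ge> 0")
        case False
        then have "g ((- t) *\<^sub>R x) = - t * g x" by (intro sublinear_scale[OF g(1)]) simp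
        then show ?thesis using minus[of "t *\<^sub>R x"] by simp
      qed (simp add: sublinear_scale[OF g(1)])
    qed
    have "- g z \<le> - p z"
      using g(2) sublinear_reduct_minus[OF p, of z] minus by (auto simp: le_fun_def dest!: spec[of _ "- z"])
    then show "g z = p z" using le[of z] by simp
  qed (rule le)
qed

section \<open>Weak topologies of reflexive spaces\<close>

lemma sublinear_infdist:
  fixes M :: "'a::real_normed_vector set"
  assumes M: "subspace M"
  shows "sublinear (\<lambda>x. infdist x M)"
proof -
  have ne: "M \<noteq> {}" using subspace_0[OF M] by auto
  have low: "infdist x M \<le> norm (x - m)" if "m \<in> M" for x m
    using infdist_le[OF that, of x] by (simp add: dist_norm)
  have great: "c \<le> infdist x M" if "\<And>m. m \<in> M \<Longrightarrow> c \<le> norm (x - m)" for c x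
    unfolding infdist_notempty[OF ne] using that by (intro cINF_greatest[OF ne]) (simp add: dist_norm)
  show ?thesis
  proof (rule sublinearI)
    show "infdist (x + y) M \<le> infdist x M + infdist y M" for x y
    proof -
      have "infdist (x + y) M - norm (y - m') \<le> infdist x M" if m': "m' \<in> M" for m'
      proof (rule great)
        fix m assume "m \<in> M"
        then have "infdist (x + y) M \<le> norm ((x + y) - (m + m'))"
          using m' by (intro low subspace_add[OF M])
        also have "\<dots> = norm ((x - m) + (y - m'))" by (simp add: algebra_simps)
        also have "\<dots> \<le> norm (x - m) + norm (y - m')" by (rule norm_triangle_ineq)
        finally show "infdist (x + y) M - norm (y - m') \<le> norm (x - m)" by simp
      qed
      then have "infdist (x + y) M - infdist x M \<le> norm (y - m')" if "m' \<in> M" for m'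
        using that by fastforce
      then have "infdist (x + y) M - infdist x M \<le> infdist y M" by (rule great)
      then show ?thesis by simp
    qed
    show "infdist 0 M = 0" using subspace_0[OF M] by simp
    show "infdist (t *\<^sub>R x) M \<le> t * infdist x M" if t: "t > 0" for t x
    proof -
      have "infdist (t *\<^sub>R x) M / t \<le> infdist x M"
      proof (rule great)
        fix m assume "m \<in> M"
        then have "infdist (t *\<^sub>R x) M \<le> norm (t *\<^sub>R x - t *\<^sub>R m)"
          by (intro low subspace_scale[OF M])
        also have "\<dots> = t * norm (x - m)"
          using t by (simp flip: scaleR_diff_right)
        finally show "infdist (t *\<^sub>R x) M / t \<le> norm (x - m)" using t by (simp add: field_simps)
      qed
      then show ?thesis using t by (simp add: field_simps)
    qed
  qed
qed

text \<open>
  The real bilinear form \<open>(c, d) \<mapsto> inner (c * d) 1\<close> is nondegenerate because \<open>'k\<close> is a field.  For the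
  complex numbers \<open>inner c 1\<close> is the real part of \<open>c\<close>, so this form plays the role of the real part in
  the passage from real-linear to \<open>'k\<close>-linear functionals.
\<close>

lemma trace_form_representation:
  fixes h :: "'k::{real_normed_field, euclidean_space} \<Rightarrow> real"
  assumes "linear h"
  shows "\<exists>!d. \<forall>c. inner (c * d) 1 = h c"
proof -
  have one: "inner (1::'k) 1 = 1" by (simp add: dot_square_norm)
  define \<Lambda> where "\<Lambda> d = adjoint (\<lambda>c. c * d) (1::'k)" for d
  have lin: "linear (\<lambda>c. c * d)" for d :: 'k
    by (simp add: linear_iff algebra_simps)
  have \<Lambda>: "inner c (\<Lambda> d) = inner (c * d) 1" for c d
    unfolding \<Lambda>_def by (rule adjoint_works[OF lin])
  have "linear \<Lambda>"
  proof (rule linearI)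
    show "\<Lambda> (d + d') = \<Lambda> d + \<Lambda> d'" for d d'
      by (rule vector_eq_ldot[THEN iffD1]) (simp add: \<Lambda> algebra_simps)
    show "\<Lambda> (t *\<^sub>R d) = t *\<^sub>R \<Lambda> d" for t d
      by (rule vector_eq_ldot[THEN iffD1]) (simp add: \<Lambda>)
  qed
  moreover have "inj \<Lambda>"
    unfolding linear_injective_0[OF \<open>linear \<Lambda>\<close>]
  proof (intro allI impI, rule ccontr)
    fix d assume "\<Lambda> d = 0" "d \<noteq> 0"
    then show False using \<Lambda>[of "inverse d" d] one by simp
  qed
  ultimately have "surj \<Lambda>" by (rule linear_injective_imp_surjective) simp
  have h: "inner c (adjoint h 1) = h c" for c
    using adjoint_works[OF assms, of c 1] by simp
  obtain d where d: "\<Lambda> d = adjoint h 1" using \<open>surj \<Lambda>\<close> by (metis surjD)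
  show ?thesis
  proof (rule ex1I[of _ d])
    show "\<forall>c. inner (c * d) 1 = h c" using \<Lambda> d h by metis
    fix d' assume "\<forall>c. inner (c * d') 1 = h c"
    then have "\<forall>c. inner c (\<Lambda> d') = inner c (\<Lambda> d)" using \<Lambda> d h by metis
    then have "\<Lambda> d' = \<Lambda> d" unfolding vector_eq_ldot .
    then show "d' = d" using \<open>inj \<Lambda>\<close> by (simp add: inj_eq)
  qed
qed

context normed_space_over
begin

lemma linear_scale_left: "linear (\<lambda>c. scale c x)"
proof (rule linearI)
  show "scale (t *\<^sub>R d) x = t *\<^sub>R scale d x" for t d
    by (metis scale_of_real scale_scale scaleR_conv_of_real)
qed (rule scale_left_distrib)

text \<open>
  The complexification of a real functional, uniformly in the scalar field: \<open>f x\<close> is the scalar that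
  represents \<open>c \<mapsto> g (scale c x)\<close>.  The norm does not grow, because multiplying \<open>x\<close> by a suitable scalar
  of norm one makes \<open>f x\<close> a nonnegative real number, which is then a value of \<open>g\<close>.
\<close>

lemma functional_with_real_part:
  assumes g: "linear g" and le: "\<And>x. g x \<le> norm x"
  obtains f where "f \<in> dual_space scale" "norm f \<le> 1"
    "\<And>x. inner (blinfun_apply f x) 1 = g x"
proof -
  have "linear (\<lambda>c. g (scale c x))" for x
    using linear_compose[OF linear_scale_left g] by (simp add: o_def)
  then have ex1: "\<exists>!d. \<forall>c. inner (c * d) 1 = g (scale c x)" for x
    by (rule trace_form_representation)
  define F where "F x = (THE d. \<forall>c. inner (c * d) 1 = g (scale c x))" for x
  have F: "inner (c * F x) 1 = g (scale c x)" for c x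
    using theI'[OF ex1] unfolding F_def by blast
  have Feq: "F x = d" if "\<And>c. inner (c * d) 1 = g (scale c x)" for x d
    unfolding F_def using ex1[of x] that by (intro the1_equality) auto
  have scale: "F (scale c x) = c * F x" for c x
  proof (rule Feq)
    fix b
    have "inner (b * (c * F x)) 1 = inner ((b * c) * F x) 1" by (simp add: mult.assoc)
    also have "\<dots> = g (scale b (scale c x))" by (simp add: F)
    finally show "inner (b * (c * F x)) 1 = g (scale b (scale c x))" .
  qed
  have bound: "norm (F x) \<le> norm x" for x
  proof (cases "F x = 0")
    case False
    define c where "c = of_real (norm (F x)) / F x"
    have "norm c = 1" using False by (simp add: c_def norm_divide)
    have "norm (F x) = inner (of_real (norm (F x)) :: 'k) 1"
      by (simp add: of_real_def dot_square_norm)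
    also have "\<dots> = inner (c * F x) 1" using False by (simp add: c_def)
    also have "\<dots> \<le> norm (scale c x)" unfolding F by (rule le)
    finally show ?thesis using \<open>norm c = 1\<close> by (simp add: norm_scale)
  qed simp
  have "bounded_linear F"
  proof
    show "F (x + y) = F x + F y" for x y
      by (rule Feq) (simp add: F distrib_left inner_add_left scale_right_distrib linear_add[OF g])
    show "F (t *\<^sub>R x) = t *\<^sub>R F x" for t x
      using scale[of "of_real t" x] by (simp add: scale_of_real scaleR_conv_of_real)
    show "\<exists>K. \<forall>x. norm (F x) \<le> norm x * K" using bound by (intro exI[of _ 1]) simp
  qed
  then have app: "blinfun_apply (Blinfun F) = F" by (rule bounded_linear_Blinfun_apply)
  show ?thesis
  proof (rule that[of "Blinfun F"])
    show "Blinfun F \<in> dual_space scale" by (simp add: dual_space_def app scale)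
    show "norm (Blinfun F) \<le> 1" using bound by (intro norm_blinfun_bound) (auto simp: app)
    show "inner (blinfun_apply (Blinfun F) x) 1 = g x" for x
      using F[of 1 x] by (simp add: app)
  qed
qed

end

text \<open>
  Apply the Hahn--Banach theorem to the distance from \<open>M\<close>, which vanishes on \<open>M\<close> and is dominated by the
  norm.
\<close>

lemma functional_separating_from_subspace:
  fixes s :: "'k::{real_normed_field, euclidean_space} \<Rightarrow> 'a::real_normed_vector \<Rightarrow> 'a"
  assumes s: "normed_space_over s" and M: "subspace M"
  obtains f where "f \<in> dual_space s" "norm f \<le> 1"
    "\<And>m. m \<in> M \<Longrightarrow> inner (blinfun_apply f m) 1 = 0" "inner (blinfun_apply f z) 1 = infdist z M"
proof -
  obtain g where g: "linear g" "\<And>x. g x \<le> infdist x M" "g z = infdist z M"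
    using Hahn_Banach[OF sublinear_infdist[OF M]] by blast
  have "g x \<le> norm x" for x
    using g(2)[of x] infdist_le[OF subspace_0[OF M], of x] by (simp add: order_trans)
  then obtain f where f: "f \<in> dual_space s" "norm f \<le> 1"
      "\<And>x. inner (blinfun_apply f x) 1 = g x"
    using normed_space_over.functional_with_real_part[OF s g(1)] by blast
  have "g m = 0" if "m \<in> M" for m
  proof -
    have "g m \<le> 0" using g(2)[of m] that by simp
    moreover have "g (- m) \<le> 0" using g(2)[of "- m"] subspace_neg[OF M that] by simp
    ultimately show ?thesis by (simp add: linear_neg[OF g(1)])
  qed
  then show ?thesis using f g(3) by (intro that[of f]) auto
qed

lemma norming_functional:
  fixes s :: "'k::{real_normed_field, euclidean_space} \<Rightarrow> 'a::real_normed_vector \<Rightarrow> 'a"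
  assumes s: "normed_space_over s"
  obtains f where "f \<in> dual_space s" "norm f \<le> 1" "inner (blinfun_apply f z) 1 = norm z"
  using functional_separating_from_subspace[OF s subspace_single_0, of z] by auto

text \<open>
  Bounded maps that are merely real-linear are assigned the value \<open>0\<close>, so that one product over the whole
  type can serve as the ambient space.
\<close>

definition weak_evaluation ::
  "('k \<Rightarrow> 'a \<Rightarrow> 'a) \<Rightarrow> 'a::real_normed_vector \<Rightarrow>
    ('a \<Rightarrow>\<^sub>L 'k::{real_normed_field, euclidean_space}) \<Rightarrow> 'k" where
  "weak_evaluation s x f = (if f \<in> dual_space s then blinfun_apply f x else 0)"

lemma inj_weak_evaluation:
  assumes "normed_space_over s"
  shows "inj (weak_evaluation s)"
proof (rule injI)
  fix x y assume eq: "weak_evaluation s x = weak_evaluation s y"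
  obtain f where "f \<in> dual_space s" "inner (blinfun_apply f (x - y)) 1 = norm (x - y)"
    by (rule norming_functional[OF assms])
  then show "x = y"
    using fun_cong[OF eq, of f] by (simp add: weak_evaluation_def blinfun.diff_right)
qed

text \<open>
  As for dual balls, the image of the ball is cut out by pointwise closed conditions.  Reflexivity turns a
  solution into a vector \<open>x\<close>, a norming functional shows that \<open>x\<close> lies in the ball, and a functional
  whose real part \<open>inner (f m) 1\<close> vanishes on \<open>M\<close> shows that \<open>x\<close> lies in \<open>M\<close>.
\<close>

lemma compactin_weak_ball:
  fixes s :: "'k::{real_normed_field, euclidean_space} \<Rightarrow> 'a::real_normed_vector \<Rightarrow> 'a"
  assumes s: "normed_space_over s" and refl: "reflexive_space s" and M: "subspace M" "closed M"
  shows "compactin (evaluation_topology (weak_evaluation s)) (M \<inter> cball a r)"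
proof (rule compactin_evaluation_topology)
  show "norm (weak_evaluation s x f) \<le> norm f * (norm a + r)" if "x \<in> M \<inter> cball a r" for x f
  proof -
    have r: "norm x \<le> norm a + r"
      using that norm_triangle_ineq[of a "x - a"] by (simp add: dist_norm norm_minus_commute)
    have "norm (weak_evaluation s x f) \<le> norm f * norm x"
      using norm_blinfun[of f x] by (simp add: weak_evaluation_def)
    also have "\<dots> \<le> norm f * (norm a + r)" using r by (intro mult_left_mono) auto
    finally show ?thesis .
  qed
  show "closed (weak_evaluation s ` (M \<inter> cball a r))"
  proof (cases "r \<ge> 0")
    case True
    let ?Y = "dual_space s"
    have "weak_evaluation s ` (M \<inter> cball a r) = {\<phi>. (\<forall>f. f \<notin> ?Y \<longrightarrow> \<phi> f = 0) \<and>
        (\<forall>f g. f \<in> ?Y \<and> g \<in> ?Y \<longrightarrow> \<phi> (f + g) = \<phi> f + \<phi> g) \<and>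
        (\<forall>c f. f \<in> ?Y \<longrightarrow> \<phi> (dual_scale c f) = c * \<phi> f) \<and>
        (\<forall>f. f \<in> ?Y \<longrightarrow> norm (\<phi> f - blinfun_apply f a) \<le> r * norm f) \<and>
        (\<forall>f. f \<in> ?Y \<and> (\<forall>m\<in>M. inner (blinfun_apply f m) 1 = 0) \<longrightarrow> inner (\<phi> f) 1 = 0)}"
      (is "?L = ?R")
    proof (intro set_eqI iffI)
      fix \<phi> assume "\<phi> \<in> ?L"
      then obtain x where x: "x \<in> M" "dist a x \<le> r" "\<phi> = weak_evaluation s x" by auto
      have "norm (blinfun_apply f x - blinfun_apply f a) \<le> r * norm f" for f :: "'a \<Rightarrow>\<^sub>L 'k"
      proof -
        have "norm (blinfun_apply f (x - a)) \<le> norm f * norm (x - a)" by (rule norm_blinfun)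
        also have "\<dots> \<le> norm f * r"
          using x(2) by (intro mult_left_mono) (simp_all add: dist_norm norm_minus_commute)
        finally show ?thesis by (simp add: blinfun.diff_right mult.commute)
      qed
      moreover have "f + g \<in> ?Y" if "f \<in> ?Y" "g \<in> ?Y" for f g
        using that by (simp add: dual_space_def blinfun.add_left distrib_left)
      moreover have "dual_scale c f \<in> ?Y" if "f \<in> ?Y" for c f
        using that by (simp add: dual_space_def dual_scale_apply mult.left_commute)
      ultimately show "\<phi> \<in> ?R"
        using x(1) unfolding x(3)
        by (auto simp: weak_evaluation_def blinfun.add_left dual_scale_apply)
    next
      fix \<phi> assume \<phi>: "\<phi> \<in> ?R"
      have "norm (\<phi> f) \<le> (r + norm a) * norm f" if "f \<in> ?Y" for f
      proof -
        have "norm (\<phi> f) \<le> norm (\<phi> f - blinfun_apply f a) + norm (blinfun_apply f a)"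
          using norm_triangle_ineq[of "\<phi> f - blinfun_apply f a" "blinfun_apply f a"] by simp
        also have "\<dots> \<le> r * norm f + norm f * norm a"
          using \<phi> that norm_blinfun by (intro add_mono) auto
        finally show ?thesis by (simp add: algebra_simps)
      qed
      then have "bounded_linear_on dual_scale (*) ?Y \<phi>"
        using \<phi> unfolding bounded_linear_on_def by blast
      then obtain x where x: "\<And>f. f \<in> ?Y \<Longrightarrow> \<phi> f = blinfun_apply f x"
        using refl unfolding reflexive_space_def by blast
      have "\<phi> = weak_evaluation s x"
        using \<phi> x by (auto simp: weak_evaluation_def)
      moreover have "x \<in> cball a r"
      proof -
        obtain f where f: "f \<in> ?Y" "norm f \<le> 1" "inner (blinfun_apply f (x - a)) 1 = norm (x - a)"
          by (rule norming_functional[OF s])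
        have "norm (x - a) \<le> norm (blinfun_apply f (x - a)) * norm (1::'k)"
          unfolding f(3)[symmetric] by (rule norm_cauchy_schwarz)
        also have "\<dots> \<le> r * norm f"
        proof -
          have "norm (\<phi> f - blinfun_apply f a) \<le> r * norm f" using \<phi> f(1) by blast
          then show ?thesis unfolding x[OF f(1)] by (simp add: blinfun.diff_right)
        qed
        also have "\<dots> \<le> r" using f(2) True by (simp add: mult_left_le)
        finally show ?thesis by (simp add: dist_norm norm_minus_commute)
      qed
      moreover have "x \<in> M"
      proof -
        obtain f where f: "f \<in> ?Y" "\<And>m. m \<in> M \<Longrightarrow> inner (blinfun_apply f m) 1 = 0"
            "inner (blinfun_apply f x) 1 = infdist x M"
          using functional_separating_from_subspace[OF s M(1), of x] by metis
        then have "infdist x M = 0" using \<phi> x[OF f(1)] by auto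
        then show ?thesis
          using in_closed_iff_infdist_zero[OF M(2)] subspace_0[OF M(1)] by blast
      qed
      ultimately show "\<phi> \<in> ?L" by blast
    qed
    moreover have "closed ?R"
      by (intro closed_Collect_conj closed_Collect_all closed_Collect_imp open_Collect_const
          closed_Collect_eq closed_Collect_le continuous_intros continuous_on_product_coordinates)
    ultimately show ?thesis by simp
  qed simp
qed

text \<open>
  \<open>D\<close> consists of the rational linear combinations of elements of \<open>S\<close>.  Rational scalars keep it
  countable, and their density makes its closure a real subspace, in which balls are weakly compact when
  the whole space is reflexive.
\<close>

lemma separable_subspace_containing:
  fixes S :: "'a::real_normed_vector set"
  assumes S: "countable S"
  obtains D where "countable D" "S \<subseteq> D" "subspace (closure D)"
    "\<And>T. bounded_linear T \<Longrightarrow> T ` S \<subseteq> S \<Longrightarrow> T ` D \<subseteq> D"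
proof -
  define comb where "comb l = (\<Sum>(q, v)\<leftarrow>l. real_of_rat q *\<^sub>R v)" for l :: "(rat \<times> 'a) list"
  define D where "D = comb ` lists (UNIV \<times> S)"
  have add: "x + y \<in> D" if xy: "x \<in> D" "y \<in> D" for x y
  proof -
    obtain l l' where l: "l \<in> lists (UNIV \<times> S)" "x = comb l" "l' \<in> lists (UNIV \<times> S)" "y = comb l'"
      using xy unfolding D_def by blast
    then have "x + y = comb (l @ l')" by (simp add: comb_def)
    moreover have "l @ l' \<in> lists (UNIV \<times> S)" using l by simp
    ultimately show ?thesis unfolding D_def by blast
  qed
  have scale: "real_of_rat q *\<^sub>R x \<in> D" if x: "x \<in> D" for q x
  proof -
    obtain l where l: "l \<in> lists (UNIV \<times> S)" "x = comb l" using x unfolding D_def by blast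
    have "real_of_rat q *\<^sub>R comb l = comb (map (\<lambda>(p, v). (q * p, v)) l)"
      by (induction l) (auto simp: comb_def of_rat_mult scaleR_add_right)
    moreover have "map (\<lambda>(p, v). (q * p, v)) l \<in> lists (UNIV \<times> S)"
      using l(1) by (induction l) auto
    ultimately show ?thesis unfolding D_def l(2) by blast
  qed
  have S_sub: "S \<subseteq> D"
  proof
    fix v assume "v \<in> S"
    then have "[(1, v)] \<in> lists (UNIV \<times> S)" by simp
    moreover have "v = comb [(1, v)]" by (simp add: comb_def)
    ultimately show "v \<in> D" unfolding D_def by (rule image_eqI[rotated])
  qed
  show ?thesis
  proof (rule that[of D])
    show "countable D"
      unfolding D_def using S by (intro countable_image countable_lists countable_SIGMA) auto
    show "S \<subseteq> D" by (rule S_sub)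
    show "subspace (closure D)"
      unfolding subspace_def
    proof (intro conjI ballI allI)
      have "comb [] \<in> D" unfolding D_def by (rule imageI) simp
      then show "0 \<in> closure D" using closure_subset by (auto simp: comb_def)
      show "x + y \<in> closure D" if xy: "x \<in> closure D" "y \<in> closure D" for x y
      proof -
        obtain u v where "\<And>n. u n \<in> D" "u \<longlonglongrightarrow> x" "\<And>n. v n \<in> D" "v \<longlonglongrightarrow> y"
          using xy unfolding closure_sequential by blast
        then have "\<forall>n. u n + v n \<in> D" "(\<lambda>n. u n + v n) \<longlonglongrightarrow> x + y"
          using add by (blast, intro tendsto_add)
        then show ?thesis unfolding closure_sequential by (intro exI conjI)
      qed
      show "c *\<^sub>R x \<in> closure D" if x: "x \<in> closure D" for c x
      proof -
        obtain u where u: "\<And>n. u n \<in> D" "u \<longlonglongrightarrow> x"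
          using x unfolding closure_sequential by blast
        have "\<exists>q. c < real_of_rat q \<and> real_of_rat q < c + 1 / real (Suc n)" for n
          by (rule of_rat_dense) simp
        then obtain q where q: "\<And>n. c < real_of_rat (q n)"
            "\<And>n. real_of_rat (q n) < c + 1 / real (Suc n)"
          by metis
        have "(\<lambda>n. c + 1 / real (Suc n)) \<longlonglongrightarrow> c + 0"
          by (intro tendsto_add tendsto_const LIMSEQ_Suc[OF lim_1_over_n])
        then have upper: "(\<lambda>n. c + 1 / real (Suc n)) \<longlonglongrightarrow> c" by simp
        have "(\<lambda>n. real_of_rat (q n)) \<longlonglongrightarrow> c"
        proof (rule tendsto_sandwich[OF _ _ tendsto_const upper])
          show "\<forall>\<^sub>F n in sequentially. c \<le> real_of_rat (q n)"
            by (rule always_eventually, rule allI, rule less_imp_le, rule q(1))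
          show "\<forall>\<^sub>F n in sequentially. real_of_rat (q n) \<le> c + 1 / real (Suc n)"
            by (rule always_eventually, rule allI, rule less_imp_le, rule q(2))
        qed
        then have "(\<lambda>n. real_of_rat (q n) *\<^sub>R u n) \<longlonglongrightarrow> c *\<^sub>R x"
          using u(2) by (rule tendsto_scaleR)
        moreover have "real_of_rat (q n) *\<^sub>R u n \<in> D" for n by (rule scale[OF u(1)])
        ultimately show ?thesis
          unfolding closure_sequential by (intro exI[of _ "\<lambda>n. real_of_rat (q n) *\<^sub>R u n"]) simp
      qed
    qed
    show "T ` D \<subseteq> D" if T: "bounded_linear T" "T ` S \<subseteq> S" for T
    proof (rule image_subsetI)
      fix x assume "x \<in> D"
      then obtain l where l: "l \<in> lists (UNIV \<times> S)" "x = comb l" unfolding D_def by blast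
      interpret T: bounded_linear T by fact
      have "T (comb l) = comb (map (\<lambda>(q, v). (q, T v)) l)"
        by (induction l) (auto simp: comb_def T.zero T.add T.scale)
      moreover have "map (\<lambda>(q, v). (q, T v)) l \<in> lists (UNIV \<times> S)"
        using l(1) T(2) by (induction l) auto
      ultimately show "T x \<in> D" unfolding l(2) by (simp add: D_def)
    qed
  qed
qed

lemma bounded_linear_operator:
  assumes "normed_space_over s" "operator_on s UNIV T"
  shows "bounded_linear T"
proof
  interpret normed_space_over s by fact
  have T: "T (x + y) = T x + T y" "T (s c x) = s c (T x)" "\<exists>K. \<forall>x. norm (T x) \<le> K * norm x" for x y c
    using assms(2) by (auto simp: operator_on_def bounded_linear_on_def)
  show "T (x + y) = T x + T y" for x y by (rule T)
  show "T (t *\<^sub>R x) = t *\<^sub>R T x" for t x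
    using T(2)[of "of_real t" x] by (simp add: scale_of_real)
  show "\<exists>K. \<forall>x. norm (T x) \<le> norm x * K" using T(3) by (simp add: mult.commute)
qed

text \<open>
  The closed subspace generated by the two-sided orbit of \<open>x\<close> is separable and invariant under \<open>T\<close> and its
  inverse.  Recurrence is a matter of visits to norm balls, so it does not depend on whether a point is
  viewed in the subspace or in the whole space.
\<close>

lemma reflexive_FRec_near_RRec:
  fixes s :: "'k::{real_normed_field, euclidean_space} \<Rightarrow> 'x::real_normed_vector \<Rightarrow> 'x"
  assumes s: "normed_space_over s" and refl: "reflexive_space s"
    and T: "operator_on s UNIV T" "operator_on s UNIV T'"
    and inverses: "\<And>x. T' (T x) = x" "\<And>x. T (T' x) = x"
    and x: "x \<in> RRec UNIV T" and e: "e > 0"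
  shows "\<exists>y\<in>FRec UNIV T \<inter> FRec UNIV T'. y \<in> cball x e"
proof -
  note bl = bounded_linear_operator[OF s T(1)] bounded_linear_operator[OF s T(2)]
  let ?S = "range (\<lambda>n. (T ^^ n) x) \<union> range (\<lambda>n. (T' ^^ n) x)"
  have "T ((T ^^ n) x) \<in> ?S" "T' ((T' ^^ n) x) \<in> ?S" for n
    by (rule UnI1 UnI2, rule range_eqI[of _ _ "Suc n"], simp)+
  moreover have "T ((T' ^^ n) x) \<in> ?S" "T' ((T ^^ n) x) \<in> ?S" for n
    using \<open>\<And>n. T ((T ^^ n) x) \<in> ?S\<close>[of 0] \<open>\<And>n. T' ((T' ^^ n) x) \<in> ?S\<close>[of 0]
    by (cases n; simp add: inverses)+
  ultimately have S: "T ` ?S \<subseteq> ?S" "T' ` ?S \<subseteq> ?S" by blast+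
  obtain D where D: "countable D" "?S \<subseteq> D" "subspace (closure D)" "T ` D \<subseteq> D" "T' ` D \<subseteq> D"
    using separable_subspace_containing[of ?S] S bl by (metis countable_Un countable_image countableI_type)
  let ?X = "closure D"
  have maps: "T ` ?X \<subseteq> ?X" "T' ` ?X \<subseteq> ?X"
    using closure_bounded_linear_image_subset[OF bl(1), of D] closure_mono[OF D(4)]
      closure_bounded_linear_image_subset[OF bl(2), of D] closure_mono[OF D(5)] by auto
  interpret compact_ball_dynamics "evaluation_topology (weak_evaluation s)" ?X T T'
  proof
    show "Hausdorff_space (evaluation_topology (weak_evaluation s))"
      by (rule Hausdorff_evaluation_topology[OF inj_weak_evaluation[OF s]])
    show "compactin (evaluation_topology (weak_evaluation s)) (?X \<inter> cball a r)" for a r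
      by (rule compactin_weak_ball[OF s refl D(3) closed_closure])
    show "\<exists>D'. countable D' \<and> D' \<subseteq> ?X \<and> ?X \<subseteq> closure D'"
      using D(1) closure_subset by blast
    show "\<exists>K. \<forall>x\<in>?X. norm (T x) \<le> K * norm x" "\<exists>K. \<forall>x\<in>?X. norm (T' x) \<le> K * norm x"
      using T by (auto simp: operator_on_def bounded_linear_on_def)
    show "continuous_map (subtopology (evaluation_topology (weak_evaluation s)) (?X \<inter> cball 0 r))
        (evaluation_topology (weak_evaluation s)) T" for r
    proof (rule continuous_map_evaluation_topology)
      fix f :: "'x \<Rightarrow>\<^sub>L 'k"
      have app: "blinfun_apply (Blinfun T) = T" by (rule bounded_linear_Blinfun_apply[OF bl(1)])
      show "\<exists>g. \<forall>y\<in>?X \<inter> cball 0 r. weak_evaluation s (T y) f = weak_evaluation s y g"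
      proof (cases "f \<in> dual_space s")
        case True
        then have "f o\<^sub>L Blinfun T \<in> dual_space s"
          using T(1) by (simp add: dual_space_def app operator_on_def bounded_linear_on_def)
        then show ?thesis
          using True by (intro exI[of _ "f o\<^sub>L Blinfun T"]) (simp add: weak_evaluation_def app)
      qed (auto simp: weak_evaluation_def)
    qed
  qed (use maps inverses in auto)
  have "x \<in> ?X"
    using D(2) closure_subset[of D] rangeI[of "\<lambda>n. (T ^^ n) x" 0] by auto
  obtain y where y: "y \<in> cball x e"
      "\<And>d. d > 0 \<Longrightarrow> lower_density {n. (T ^^ n) y \<in> ball y d} > 0"
      "\<And>d. d > 0 \<Longrightarrow> lower_density {n. (T' ^^ n) y \<in> ball y d} > 0"
    using frequently_recurrent_near[OF \<open>x \<in> ?X\<close> RRecD[OF x e]] by metis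
  then show ?thesis
    by (intro bexI[of _ y] IntI FRecI) auto
qed

section \<open>Recurrence of inverses of adjoint operators\<close>

theorem corollary6p4:
  fixes sY :: "'k::{real_normed_field, euclidean_space} \<Rightarrow> 'y::banach \<Rightarrow> 'y"
    and sX :: "'k \<Rightarrow> 'x::banach \<Rightarrow> 'x"
  shows
    "(\<forall>T :: ('y \<Rightarrow>\<^sub>L 'k) \<Rightarrow> ('y \<Rightarrow>\<^sub>L 'k).
        normed_space_over sY \<and>
        separable_space (top_of_set (dual_space sY)) \<and>
        is_adjoint sY T \<and>
        invertible_operator_on dual_scale (dual_space sY) T
        \<longrightarrow>
        closure (RRec (dual_space sY) T) = closure (FRec (dual_space sY) T) \<and>
        closure (FRec (dual_space sY) T) = closure (FRec (dual_space sY) (inv_into (dual_space sY) T)) \<and>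
        closure (FRec (dual_space sY) (inv_into (dual_space sY) T)) = closure (RRec (dual_space sY) (inv_into (dual_space sY) T)) \<and>
        (reiteratively_recurrent (dual_space sY) T \<longleftrightarrow> reiteratively_recurrent (dual_space sY) (inv_into (dual_space sY) T)) \<and>
        (frequently_recurrent (dual_space sY) T \<longleftrightarrow> frequently_recurrent (dual_space sY) (inv_into (dual_space sY) T)) \<and>
        (reiteratively_recurrent (dual_space sY) T \<longleftrightarrow> frequently_recurrent (dual_space sY) T) \<and>
        (RRec (dual_space sY) T - {0} \<noteq> {} \<longrightarrow>
          (FRec (dual_space sY) T \<inter> FRec (dual_space sY) (inv_into (dual_space sY) T)) - {0} \<noteq> {})) \<and>
     (\<forall>T :: 'x \<Rightarrow> 'x.
        normed_space_over sX \<and>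
        reflexive_space sX \<and>
        invertible_operator_on sX UNIV T
        \<longrightarrow>
        closure (RRec UNIV T) = closure (FRec UNIV T) \<and>
        closure (FRec UNIV T) = closure (FRec UNIV (inv_into UNIV T)) \<and>
        closure (FRec UNIV (inv_into UNIV T)) = closure (RRec UNIV (inv_into UNIV T)) \<and>
        (reiteratively_recurrent UNIV T \<longleftrightarrow> reiteratively_recurrent UNIV (inv_into UNIV T)) \<and>
        (frequently_recurrent UNIV T \<longleftrightarrow> frequently_recurrent UNIV (inv_into UNIV T)) \<and>
        (reiteratively_recurrent UNIV T \<longleftrightarrow> frequently_recurrent UNIV T) \<and>
        (RRec UNIV T - {0} \<noteq> {} \<longrightarrow>
          (FRec UNIV T \<inter> FRec UNIV (inv_into UNIV T)) - {0} \<noteq> {}))"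
proof (intro conjI[of "\<forall>T. _ T"] allI impI, goal_cases)
  case (1 T)
  then interpret compact_ball_dynamics "evaluation_topology blinfun_apply" "dual_space sY"
    T "inv_into (dual_space sY) T"
    by (intro dual_compact_ball_dynamics) auto
  interpret inverse: compact_ball_dynamics "evaluation_topology blinfun_apply" "dual_space sY"
    "inv_into (dual_space sY) T" T
    by (rule inverse_dynamics)
  show ?case
    by (rule recurrence_of_inverse[OF FRec_near_RRec])
      (use inverse.FRec_near_RRec in \<open>auto simp: Int_commute\<close>)
next
  case (2 T)
  then have s: "normed_space_over sX" and refl: "reflexive_space sX"
    and T: "operator_on sX UNIV T" "operator_on sX UNIV (inv_into UNIV T)" and "bij T"
    by (auto simp: invertible_operator_on_def)
  then have inverses: "inv_into UNIV T (T x) = x" "T (inv_into UNIV T x) = x" for x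
    by (simp_all add: bij_is_inj bij_is_surj surj_f_inv_f)
  show ?case
  proof (rule recurrence_of_inverse)
    show "\<exists>y\<in>FRec UNIV T \<inter> FRec UNIV (inv_into UNIV T). y \<in> cball x e"
      if "x \<in> RRec UNIV T" "e > 0" for x e
      by (rule reflexive_FRec_near_RRec[OF s refl T inverses that])
    show "\<exists>y\<in>FRec UNIV T \<inter> FRec UNIV (inv_into UNIV T). y \<in> cball x e"
      if "x \<in> RRec UNIV (inv_into UNIV T)" "e > 0" for x e
      using reflexive_FRec_near_RRec[OF s refl T(2,1) inverses(2,1) that] by (simp add: Int_commute)
  qed
qed

end
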